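(* Let $\Sigma \subseteq \mathbb{R}^n$ be a compact set for which there are constants $R_{\mathrm{Ahl}} > 0$ and $A_{\mathrm{Ahl}} > 0$ such that $\mathcal{H}^m(\Sigma \cap \mathbb{B}(x,r)) \ge A_{\mathrm{Ahl}} r^m$ for all $x \in \Sigma$ and all $0 < r \le R_{\mathrm{Ahl}}$, and let $l \in \{1,\ldots,m+2\}$. If $\mathcal{E}_p^l(\Sigma) \le E < \infty$ for some $p > ml$, then there exists a constant $C_A = C_A(m,l,p)$, depending only on $m$, $l$ and $p$, such that for all $0 < r \le R_{\mathrm{Ahl}}$ and all $x \in \Sigma$ $$\beta_m^{\Sigma}(x,r) \le C_A \left( \frac{E}{A_{\mathrm{Ahl}}^l} \right)^{1/\kappa} r^{\lambda/\kappa},$$ where $\kappa = (p+ml)(m+1)$ and $\lambda = p - ml$.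
   Context: Here $1 \le m \le n$ are integers, $\mathcal{H}^s$ is the $s$-dimensional Hausdorff measure, $\mathbb{B}(x,r)$ and $\overline{\mathbb{B}}(x,r)$ are the open and closed balls in $\mathbb{R}^n$, $G(n,m)$ is the Grassmannian of $m$-dimensional linear subspaces of $\mathbb{R}^n$, and $\bigtriangleup(x_0,\ldots,x_k)$ is the convex hull of $\{x_0,\ldots,x_k\}$. For $x_0,\ldots,x_{m+1} \in \mathbb{R}^n$ set $$\mathcal{K}(x_0,\ldots,x_{m+1}) = \frac{\mathcal{H}^{m+1}(\bigtriangleup(x_0,\ldots,x_{m+1}))}{\mathrm{diam}(x_0,\ldots,x_{m+1})^{m+2}}$$ (with value $0$ if all points coincide). For $p>0$ and $l \in \{1,\ldots,m+2\}$, $$\mathcal{E}_p^l(\Sigma) = \int_{\Sigma^l} \sup_{x_l,\ldots,x_{m+1} \in \Sigma} \mathcal{K}(x_0,\ldots,x_{m+1})^p \, d\mathcal{H}^{ml}_{x_0,\ldots,x_{l-1}}$$ (if $l=m+2$ there is no supremum). For $x\in\Sigma$, $r>0$, $$\beta_m^{\Sigma}(x,r) = \frac1r \inf_{H \in G(n,m)} \ \sup_{z \in \Sigma \cap \overline{\mathbb{B}}(x,r)} \mathrm{dist}(z, x+H).$$ *)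

theory Defs
  imports "HOL-Analysis.Analysis" "HOL-Library.Poly_Mapping"
begin

text \<open>
  A claim about a constant that does not depend on the ambient dimension \<open>n\<close> has to quantify over
  \<open>n\<close> below the quantifier for the constant, so the spaces \<open>\<real>\<^sup>n\<close> must all live in a single type.
  We use finitely supported families \<open>'i \<Rightarrow>\<^sub>0 'a\<close> with the Euclidean (\<open>\<ell>\<^sup>2\<close>) inner product.
  The type \<open>nat \<Rightarrow>\<^sub>0 real\<close> contains every \<open>\<real>\<^sup>n\<close>, and \<open>nat \<Rightarrow>\<^sub>0 (nat \<Rightarrow>\<^sub>0 real)\<close> contains every
  \<open>(\<real>\<^sup>n)\<^sup>l = \<real>\<^sup>n\<^sup>l\<close>, in both cases isometrically.
\<close>

abbreviation lookup :: "('i \<Rightarrow>\<^sub>0 'a::zero) \<Rightarrow> 'i \<Rightarrow> 'a"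
  where "lookup \<equiv> Poly_Mapping.lookup"

abbreviation keys :: "('i \<Rightarrow>\<^sub>0 'a::zero) \<Rightarrow> 'i set"
  where "keys \<equiv> Poly_Mapping.keys"

instantiation poly_mapping :: (type, real_vector) real_vector
begin

definition scaleR_poly_mapping :: "real \<Rightarrow> ('a \<Rightarrow>\<^sub>0 'b) \<Rightarrow> ('a \<Rightarrow>\<^sub>0 'b)"
  where "scaleR r x = Poly_Mapping.map (scaleR r) x"

lemma lookup_scaleR [simp]: "lookup (scaleR r x) i = scaleR r (lookup x i)"
  by (simp add: scaleR_poly_mapping_def Poly_Mapping.map.rep_eq when_def)

instance
  by standard (auto intro!: poly_mapping_eqI simp: lookup_add scaleR_add_right scaleR_add_left)

end

instantiation poly_mapping :: (type, real_inner) real_inner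
begin

definition inner_poly_mapping_def:
  "inner (x :: 'a \<Rightarrow>\<^sub>0 'b) y = (\<Sum>i\<in>keys x. lookup x i \<bullet> lookup y i)"

definition norm_poly_mapping_def:
  "norm (x :: 'a \<Rightarrow>\<^sub>0 'b) = sqrt (x \<bullet> x)"

definition sgn_poly_mapping_def:
  "sgn (x :: 'a \<Rightarrow>\<^sub>0 'b) = x /\<^sub>R norm x"

definition dist_poly_mapping_def:
  "dist (x :: 'a \<Rightarrow>\<^sub>0 'b) y = norm (x - y)"

definition uniformity_poly_mapping_def:
  "(uniformity :: (('a \<Rightarrow>\<^sub>0 'b) \<times> ('a \<Rightarrow>\<^sub>0 'b)) filter) =
    (INF e\<in>{0<..}. principal {(x, y). dist x y < e})"

definition open_poly_mapping_def:
  "open (U :: ('a \<Rightarrow>\<^sub>0 'b) set) \<longleftrightarrow> (\<forall>x\<in>U. eventually (\<lambda>(x', y). x' = x \<longrightarrow> y \<in> U) uniformity)"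

lemma inner_poly_mapping_superset:
  fixes x y :: "'a \<Rightarrow>\<^sub>0 'b"
  assumes "finite S" "keys x \<subseteq> S"
  shows "x \<bullet> y = (\<Sum>i\<in>S. lookup x i \<bullet> lookup y i)"
  unfolding inner_poly_mapping_def
  by (rule sum.mono_neutral_left) (use assms in \<open>auto simp: in_keys_iff\<close>)

instance
proof
  fix x y z :: "'a \<Rightarrow>\<^sub>0 'b" and r :: real
  let ?S = "keys x \<union> keys y"
  have S: "finite ?S" "keys x \<subseteq> ?S" "keys y \<subseteq> ?S" "keys (x + y) \<subseteq> ?S"
    using keys_add[of x y] by auto
  show "x \<bullet> y = y \<bullet> x"
    unfolding inner_poly_mapping_superset[OF S(1,2)] inner_poly_mapping_superset[OF S(1,3)]
    by (simp add: inner_commute)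
  show "(x + y) \<bullet> z = x \<bullet> z + y \<bullet> z"
    unfolding inner_poly_mapping_superset[OF S(1,2)] inner_poly_mapping_superset[OF S(1,3)]
      inner_poly_mapping_superset[OF S(1,4)]
    by (simp add: lookup_add inner_add_left sum.distrib)
  have "keys (scaleR r x) \<subseteq> keys x"
    by (auto simp: in_keys_iff)
  from inner_poly_mapping_superset[OF finite_keys this] show "scaleR r x \<bullet> y = r * (x \<bullet> y)"
    by (simp add: inner_poly_mapping_def sum_distrib_left)
  show "0 \<le> x \<bullet> x"
    by (simp add: inner_poly_mapping_def sum_nonneg)
  show "x \<bullet> x = 0 \<longleftrightarrow> x = 0"
  proof
    assume "x \<bullet> x = 0"
    then have "\<forall>i\<in>keys x. lookup x i = 0"
      by (simp add: inner_poly_mapping_def sum_nonneg_eq_0_iff)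
    then show "x = 0"
      by (intro poly_mapping_eqI) (auto simp: in_keys_iff)
  qed (simp add: inner_poly_mapping_def)
qed (auto simp: norm_poly_mapping_def sgn_poly_mapping_def dist_poly_mapping_def
       uniformity_poly_mapping_def open_poly_mapping_def)

end

type_synonym point = "nat \<Rightarrow>\<^sub>0 real"

definition real_space :: "nat \<Rightarrow> point set"
  where "real_space n = {x. \<forall>i\<ge>n. lookup x i = 0}"

definition tuples :: "nat \<Rightarrow> point set \<Rightarrow> (nat \<Rightarrow>\<^sub>0 point) set"
  where "tuples l \<Sigma> = {x. (\<forall>i<l. lookup x i \<in> \<Sigma>) \<and> (\<forall>i\<ge>l. lookup x i = 0)}"


text \<open>
  Hausdorff measure, normalised so that it agrees with Lebesgue measure on \<open>s\<close>-dimensional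
  Euclidean space.  The case distinction on \<open>U = {}\<close> only matters for \<open>s = 0\<close>.
  Series are written \<open>suminf\<close> because the binder notation clashes with that of \<open>Sum_any\<close>.
\<close>

definition hausdorff_weight :: "nat \<Rightarrow> 'a::metric_space set \<Rightarrow> ennreal"
  where "hausdorff_weight s U =
    (if U = {} then 0 else ennreal (unit_ball_vol (real s) * (diameter U / 2) ^ s))"

definition hausdorff_pre :: "nat \<Rightarrow> real \<Rightarrow> 'a::metric_space set \<Rightarrow> ennreal"
  where "hausdorff_pre s \<delta> A =
    (INF U \<in> {U :: nat \<Rightarrow> 'a set. A \<subseteq> (\<Union>i. U i) \<and> (\<forall>i. bounded (U i) \<and> diameter (U i) \<le> \<delta>)}.
       suminf (\<lambda>i. hausdorff_weight s (U i)))"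

definition hausdorff_outer :: "nat \<Rightarrow> 'a::metric_space set \<Rightarrow> ennreal"
  where "hausdorff_outer s A = (SUP \<delta>\<in>{0<..}. hausdorff_pre s \<delta> A)"

definition hausdorff_measure :: "nat \<Rightarrow> 'a::metric_space measure"
  where "hausdorff_measure s = measure_of UNIV (sets borel) (hausdorff_outer s)"

lemma space_hausdorff_measure [simp]: "space (hausdorff_measure s) = UNIV"
  by (simp add: hausdorff_measure_def)

lemma sets_hausdorff_measure [simp, measurable_cong]: "sets (hausdorff_measure s) = sets borel"
  by (simp add: hausdorff_measure_def) (metis sets.sigma_sets_eq space_borel)

text \<open>The measure \<open>measure_of\<close> builds is null unless the set function is countably additive on the
  Borel sets; \<open>emeasure_hausdorff_measure\<close> below shows that it is.\<close>

lemma hausdorff_pre_mono: "A \<subseteq> B \<Longrightarrow> hausdorff_pre s \<delta> A \<le> hausdorff_pre s \<delta> B"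
  unfolding hausdorff_pre_def by (rule INF_superset_mono) auto

lemma hausdorff_pre_antimono: "\<delta> \<le> \<epsilon> \<Longrightarrow> hausdorff_pre s \<epsilon> A \<le> hausdorff_pre s \<delta> A"
  unfolding hausdorff_pre_def by (rule INF_superset_mono) (auto intro: order_trans)

lemma hausdorff_pre_le_outer: "0 < \<delta> \<Longrightarrow> hausdorff_pre s \<delta> A \<le> hausdorff_outer s A"
  unfolding hausdorff_outer_def by (rule SUP_upper) auto

lemma hausdorff_outer_mono: "A \<subseteq> B \<Longrightarrow> hausdorff_outer s A \<le> hausdorff_outer s B"
  unfolding hausdorff_outer_def by (intro SUP_mono) (auto intro: hausdorff_pre_mono)

lemma hausdorff_pre_empty: "0 < \<delta> \<Longrightarrow> hausdorff_pre s \<delta> {} = 0"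
proof -
  assume "0 < \<delta>"
  then have "hausdorff_pre s \<delta> ({} :: 'a set) \<le> suminf (\<lambda>i. hausdorff_weight s ({} :: 'a set))"
    unfolding hausdorff_pre_def by (intro INF_lower) auto
  then show ?thesis
    by (simp add: hausdorff_weight_def)
qed

lemma hausdorff_outer_empty [simp]: "hausdorff_outer s {} = 0"
  unfolding hausdorff_outer_def
  by (rule antisym[OF SUP_least]) (auto simp: hausdorff_pre_empty)

lemma hausdorff_pre_UN_le:
  assumes "0 < \<delta>"
  shows "hausdorff_pre s \<delta> (\<Union>i. A i) \<le> suminf (\<lambda>i::nat. hausdorff_pre s \<delta> (A i))"
proof (rule ennreal_le_epsilon)
  fix e :: real
  assume fin: "suminf (\<lambda>i. hausdorff_pre s \<delta> (A i)) < top" and "0 < e"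
  have fin': "hausdorff_pre s \<delta> (A i) < top" for i
    using fin ennreal_suminf_lessD by blast
  have "\<exists>U. (A i \<subseteq> (\<Union>j::nat. U j) \<and> (\<forall>j. bounded (U j) \<and> diameter (U j) \<le> \<delta>)) \<and>
          suminf (\<lambda>j. hausdorff_weight s (U j)) \<le> hausdorff_pre s \<delta> (A i) + ennreal (e * (1/2) ^ Suc i)"
    for i
  proof -
    have "hausdorff_pre s \<delta> (A i) < hausdorff_pre s \<delta> (A i) + ennreal (e * (1/2) ^ Suc i)"
      using fin'[of i] \<open>0 < e\<close> by (auto simp: less_top[symmetric])
    then show ?thesis
      unfolding hausdorff_pre_def[of s \<delta> "A i"] INF_less_iff
      by (auto simp: hausdorff_pre_def intro: less_imp_le)
  qed
  then obtain U where U: "\<And>i. A i \<subseteq> (\<Union>j::nat. U i j)" "\<And>i j. bounded (U i j)"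
      "\<And>i j. diameter (U i j) \<le> \<delta>"
      "\<And>i. suminf (\<lambda>j. hausdorff_weight s (U i j))
        \<le> hausdorff_pre s \<delta> (A i) + ennreal (e * (1/2) ^ Suc i)"
    by metis
  define V where "V k = (case prod_decode k of (i, j) \<Rightarrow> U i j)" for k
  have "(\<Union>i. A i) \<subseteq> (\<Union>k. V k)"
  proof
    fix x assume "x \<in> (\<Union>i. A i)"
    then obtain i j where "x \<in> U i j" using U(1) by blast
    then have "x \<in> V (prod_encode (i, j))" by (simp add: V_def)
    then show "x \<in> (\<Union>k. V k)" by blast
  qed
  then have "hausdorff_pre s \<delta> (\<Union>i. A i) \<le> suminf (\<lambda>k. hausdorff_weight s (V k))"
    unfolding hausdorff_pre_def using U(2,3)
    by (intro INF_lower) (auto simp: V_def split: prod.split)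
  also have "suminf (\<lambda>k. hausdorff_weight s (V k)) = suminf (\<lambda>i. suminf (\<lambda>j. hausdorff_weight s (U i j)))"
    using suminf_ennreal_2dimen[of "\<lambda>i. suminf (\<lambda>j. hausdorff_weight s (U i j))"
        "\<lambda>(i, j). hausdorff_weight s (U i j)"]
    by (simp add: V_def o_def case_prod_beta)
  also have "\<dots> \<le> suminf (\<lambda>i. hausdorff_pre s \<delta> (A i) + ennreal (e * (1/2) ^ Suc i))"
    by (intro suminf_le U) auto
  also have "\<dots> = suminf (\<lambda>i. hausdorff_pre s \<delta> (A i)) + suminf (\<lambda>i. ennreal (e * (1/2) ^ Suc i))"
    by (rule suminf_add[symmetric]) auto
  also have "suminf (\<lambda>i. ennreal (e * (1/2) ^ Suc i)) = ennreal e"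
    using sums_mult[OF power_half_series, of e] \<open>0 < e\<close>
    by (intro suminf_ennreal_eq) auto
  finally show "hausdorff_pre s \<delta> (\<Union>i. A i) \<le> suminf (\<lambda>i. hausdorff_pre s \<delta> (A i)) + ennreal e" .
qed

lemma hausdorff_outer_UN_le:
  "hausdorff_outer s (\<Union>i. A i) \<le> suminf (\<lambda>i::nat. hausdorff_outer s (A i))"
proof -
  have "hausdorff_pre s \<delta> (\<Union>i. A i) \<le> suminf (\<lambda>i. hausdorff_outer s (A i))" if "0 < \<delta>" for \<delta>
    using hausdorff_pre_UN_le[OF that]
    by (rule order_trans) (intro suminf_le hausdorff_pre_le_outer that; simp)
  then show ?thesis
    unfolding hausdorff_outer_def[of s "\<Union>i. A i"] by (intro SUP_least) auto
qed

lemma outer_measure_space_hausdorff: "outer_measure_space (Pow UNIV) (hausdorff_outer s)"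
  unfolding outer_measure_space_def positive_def increasing_def countably_subadditive_def
  by (auto intro: hausdorff_outer_mono hausdorff_outer_UN_le)

lemma hausdorff_outer_Un_le: "hausdorff_outer s (A \<union> B) \<le> hausdorff_outer s A + hausdorff_outer s B"
proof -
  have "subadditive (Pow UNIV) (hausdorff_outer s)"
    using outer_measure_space_hausdorff[of s] sigma_algebra_Pow[of UNIV]
    by (intro ring_of_sets.countably_subadditive_subadditive[of UNIV])
       (auto simp only: outer_measure_space_def sigma_algebra_def algebra_def)
  then have "hausdorff_outer s (A \<union> (B - A)) \<le> hausdorff_outer s A + hausdorff_outer s (B - A)"
    by (rule subadditiveD) auto
  also have "\<dots> \<le> hausdorff_outer s A + hausdorff_outer s B"
    by (intro add_left_mono hausdorff_outer_mono) auto
  finally show ?thesis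
    by simp
qed

lemma hausdorff_outer_separated:
  fixes A B :: "'a::metric_space set"
  assumes e: "0 < e" and sep: "\<And>x y. x \<in> A \<Longrightarrow> y \<in> B \<Longrightarrow> e \<le> dist x y"
  shows "hausdorff_outer s A + hausdorff_outer s B \<le> hausdorff_outer s (A \<union> B)"
proof -
  have *: "hausdorff_pre s \<delta> A + hausdorff_pre s \<delta> B \<le> hausdorff_outer s (A \<union> B)"
    if \<delta>: "0 < \<delta>" "\<delta> < e" for \<delta>
  proof -
    have "hausdorff_pre s \<delta> A + hausdorff_pre s \<delta> B \<le> suminf (\<lambda>i. hausdorff_weight s (U i))"
      if U: "A \<union> B \<subseteq> (\<Union>i. U i)" "\<And>i. bounded (U i)" "\<And>i. diameter (U i) \<le> \<delta>"
      for U :: "nat \<Rightarrow> 'a set"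
    proof -
      define V where "V i = (if U i \<inter> A = {} then {} else U i)" for i
      define W where "W i = (if U i \<inter> B = {} then {} else U i)" for i
      have V: "hausdorff_pre s \<delta> A \<le> suminf (\<lambda>i. hausdorff_weight s (V i))"
        unfolding hausdorff_pre_def using U \<delta>
        by (intro INF_lower) (fastforce simp: V_def)
      have W: "hausdorff_pre s \<delta> B \<le> suminf (\<lambda>i. hausdorff_weight s (W i))"
        unfolding hausdorff_pre_def using U \<delta>
        by (intro INF_lower) (fastforce simp: W_def)
      have disj: "U i \<inter> A = {} \<or> U i \<inter> B = {}" for i
      proof (rule ccontr)
        assume "\<not> ?thesis"
        then obtain x y where "x \<in> U i" "x \<in> A" "y \<in> U i" "y \<in> B" by blast
        then have "e \<le> dist x y" "dist x y \<le> diameter (U i)"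
          using sep diameter_bounded_bound[OF U(2)] by auto
        with U(3)[of i] \<delta> show False by linarith
      qed
      have "hausdorff_pre s \<delta> A + hausdorff_pre s \<delta> B
          \<le> suminf (\<lambda>i. hausdorff_weight s (V i)) + suminf (\<lambda>i. hausdorff_weight s (W i))"
        by (rule add_mono[OF V W])
      also have "\<dots> = suminf (\<lambda>i. hausdorff_weight s (V i) + hausdorff_weight s (W i))"
        by (rule suminf_add) auto
      also have "\<dots> \<le> suminf (\<lambda>i. hausdorff_weight s (U i))"
        using disj by (intro suminf_le) (auto simp: V_def W_def hausdorff_weight_def)
      finally show ?thesis .
    qed
    then have "hausdorff_pre s \<delta> A + hausdorff_pre s \<delta> B \<le> hausdorff_pre s \<delta> (A \<union> B)"
      unfolding hausdorff_pre_def[of s \<delta> "A \<union> B"] by (intro INF_greatest) auto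
    also have "\<dots> \<le> hausdorff_outer s (A \<union> B)"
      by (rule hausdorff_pre_le_outer[OF \<delta>(1)])
    finally show ?thesis .
  qed
  have "hausdorff_pre s \<delta> A + hausdorff_pre s \<epsilon> B \<le> hausdorff_outer s (A \<union> B)"
    if "0 < \<delta>" "0 < \<epsilon>" for \<delta> \<epsilon>
  proof -
    define d where "d = min (min \<delta> \<epsilon>) (e / 2)"
    have "hausdorff_pre s \<delta> A + hausdorff_pre s \<epsilon> B \<le> hausdorff_pre s d A + hausdorff_pre s d B"
      by (intro add_mono hausdorff_pre_antimono) (auto simp: d_def)
    also have "\<dots> \<le> hausdorff_outer s (A \<union> B)"
      using that e by (intro *) (auto simp: d_def)
    finally show ?thesis .
  qed
  then have "hausdorff_pre s \<delta> A + hausdorff_outer s B \<le> hausdorff_outer s (A \<union> B)" if "0 < \<delta>" for \<delta>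
    unfolding hausdorff_outer_def[of s B] using that
    by (subst ennreal_SUP_add_right) (auto intro!: SUP_least)
  then show ?thesis
    unfolding hausdorff_outer_def[of s A]
    by (subst ennreal_SUP_add_left[symmetric]) (auto intro!: SUP_least)
qed

lemma hausdorff_outer_closed:
  fixes F T :: "'a::metric_space set"
  assumes F: "closed F"
  shows "hausdorff_outer s (T \<inter> F) + hausdorff_outer s (T - F) = hausdorff_outer s T"
proof (rule antisym)
  let ?H = "hausdorff_outer s"
  show "?H T \<le> ?H (T \<inter> F) + ?H (T - F)"
    using hausdorff_outer_Un_le[of s "T \<inter> F" "T - F"] by (simp add: Int_Diff_Un)
  show "?H (T \<inter> F) + ?H (T - F) \<le> ?H T"
  proof (cases "F = {} \<or> ?H T = top")
    case False
    then have ne: "F \<noteq> {}" and fin: "?H T < top"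
      by (auto simp: less_top)
    define A where "A k = {x\<in>T. 1 / real (k + 1) \<le> infdist x F}" for k :: nat
    define R where "R k = {x\<in>T. 1 / real (k + 2) \<le> infdist x F \<and> infdist x F < 1 / real (k + 1)}"
      for k :: nat
    have step: "(\<Sum>k<N. ?H (R (2 * k + c))) \<le> ?H (\<Union>k<N. R (2 * k + c))" for N c
    proof (induction N)
      case (Suc N)
      let ?e = "1 / real (2 * N + c) - 1 / real (2 * N + c + 1)"
      have le: "?H (\<Union>k<N. R (2 * k + c)) + ?H (R (2 * N + c))
          \<le> ?H ((\<Union>k<N. R (2 * k + c)) \<union> R (2 * N + c))"
      proof (cases "N = 0")
        case False
        show ?thesis
        proof (rule hausdorff_outer_separated)
          show "0 < ?e"
            using False by (simp add: divide_strict_left_mono)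
          fix x y assume "x \<in> (\<Union>k<N. R (2 * k + c))" and y: "y \<in> R (2 * N + c)"
          then obtain k where k: "k < N" and x: "x \<in> R (2 * k + c)" by blast
          have "1 / real (2 * N + c) \<le> 1 / real (2 * k + c + 2)"
            using k by (intro divide_left_mono) auto
          moreover have "1 / real (2 * k + c + 2) \<le> infdist x F"
            using x by (auto simp: R_def)
          moreover have "infdist y F < 1 / real (2 * N + c + 1)"
            using y by (auto simp: R_def)
          ultimately show "?e \<le> dist x y"
            using infdist_triangle[of x F y] by linarith
        qed
      qed simp
      have "(\<Sum>k<Suc N. ?H (R (2 * k + c))) = (\<Sum>k<N. ?H (R (2 * k + c))) + ?H (R (2 * N + c))"
        by (rule sum.lessThan_Suc)
      also have "\<dots> \<le> ?H (\<Union>k<N. R (2 * k + c)) + ?H (R (2 * N + c))"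
        by (rule add_right_mono[OF Suc])
      also note le
      also have "(\<Union>k<N. R (2 * k + c)) \<union> R (2 * N + c) = (\<Union>k<Suc N. R (2 * k + c))"
        by (auto simp: lessThan_Suc)
      finally show ?case .
    qed simp
    have bound: "suminf (\<lambda>k. ?H (R (2 * k + c))) \<le> ?H T" for c
    proof (rule suminf_le_const)
      fix N
      have "?H (\<Union>k<N. R (2 * k + c)) \<le> ?H T"
        by (rule hausdorff_outer_mono) (auto simp: R_def)
      with step[of c N] show "(\<Sum>k<N. ?H (R (2 * k + c))) \<le> ?H T" by (rule order_trans)
    qed simp
    have sum_fin: "suminf (\<lambda>k. ?H (R k)) \<noteq> top"
    proof -
      have "suminf (\<lambda>k. ?H (R k)) \<le> ?H T + ?H T"
      proof (rule suminf_le_const)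
        fix N
        have "(\<Sum>k<N. ?H (R k)) \<le> (\<Sum>k<2 * N. ?H (R k))"
          by (rule sum_mono2) auto
        also have "\<dots> = (\<Sum>k<N. ?H (R (2 * k + 0))) + (\<Sum>k<N. ?H (R (2 * k + 1)))"
          by (induction N) (auto simp: ac_simps)
        also have "\<dots> \<le> suminf (\<lambda>k. ?H (R (2 * k + 0))) + suminf (\<lambda>k. ?H (R (2 * k + 1)))"
          by (intro add_mono sum_le_suminf) auto
        also have "\<dots> \<le> ?H T + ?H T"
          by (intro add_mono bound)
        finally show "(\<Sum>k<N. ?H (R k)) \<le> ?H T + ?H T" .
      qed simp
      also have "\<dots> < top"
        using fin by (simp add: ennreal_add_less_top)
      finally show ?thesis by simp
    qed
    have le: "?H (T \<inter> F) + ?H (T - F) \<le> ?H T + suminf (\<lambda>j. ?H (R (j + k)))" for k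
    proof -
      have cover: "T - F \<subseteq> A k \<union> (\<Union>j. R (j + k))"
      proof
        fix x assume x: "x \<in> T - F"
        then have pos: "0 < infdist x F"
          using in_closed_iff_infdist_zero[OF F ne, of x] infdist_nonneg[of x F] by force
        show "x \<in> A k \<union> (\<Union>j. R (j + k))"
        proof (cases "x \<in> A k")
          case False
          with x have lt: "infdist x F < 1 / real (k + 1)"
            by (auto simp: A_def)
          obtain n where n: "1 / real (n + 1) \<le> infdist x F"
            using reals_Archimedean[OF pos] by (auto simp: inverse_eq_divide intro: less_imp_le)
          define m where "m = (LEAST n. 1 / real (n + 1) \<le> infdist x F)"
          have m: "1 / real (m + 1) \<le> infdist x F"
            unfolding m_def by (rule LeastI[of _ n], rule n)
          have "k < m"
          proof (rule ccontr)
            assume "\<not> k < m"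
            then have "1 / real (k + 1) \<le> 1 / real (m + 1)"
              by (intro divide_left_mono) auto
            with lt m show False by linarith
          qed
          then obtain j where j: "m = Suc (j + k)"
            by (metis add.commute less_imp_Suc_add)
          have "\<not> 1 / real (j + k + 1) \<le> infdist x F"
            using not_less_Least[of "j + k" "\<lambda>n. 1 / real (n + 1) \<le> infdist x F"] j
            by (simp add: m_def)
          with m j x have "x \<in> R (j + k)"
            by (simp add: R_def)
          then show ?thesis by blast
        qed simp
      qed
      have "?H (T \<inter> F) + ?H (A k) \<le> ?H (T \<inter> F \<union> A k)"
      proof (rule hausdorff_outer_separated)
        show "0 < 1 / real (k + 1)" by simp
        fix x y assume "x \<in> T \<inter> F" "y \<in> A k"
        then show "1 / real (k + 1) \<le> dist x y"
          using infdist_le[of x F y] by (auto simp: A_def dist_commute)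
      qed
      also have "\<dots> \<le> ?H T"
        by (rule hausdorff_outer_mono) (auto simp: A_def)
      finally have 1: "?H (T \<inter> F) + ?H (A k) \<le> ?H T" .
      have "?H (T - F) \<le> ?H (A k) + suminf (\<lambda>j. ?H (R (j + k)))"
        using hausdorff_outer_mono[OF cover, of s] hausdorff_outer_Un_le[of s "A k" "\<Union>j. R (j + k)"]
          add_left_mono[OF hausdorff_outer_UN_le[of s "\<lambda>j. R (j + k)"], of "?H (A k)"]
        by (meson order_trans)
      then have "?H (T \<inter> F) + ?H (T - F) \<le> (?H (T \<inter> F) + ?H (A k)) + suminf (\<lambda>j. ?H (R (j + k)))"
        by (simp add: add.assoc add_left_mono)
      with 1 show ?thesis
        by (meson add_right_mono order_trans)
    qed
    have fink: "?H (R k) \<noteq> top" for k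
      using sum_fin ennreal_suminf_lessD[of "\<lambda>k. ?H (R k)" top k] by (auto simp: less_top)
    have "(\<lambda>k. suminf (\<lambda>j. ?H (R (j + k)))) \<longlonglongrightarrow> 0"
    proof -
      define g where "g k = enn2real (?H (R k))" for k
      have g: "?H (R k) = ennreal (g k)" "0 \<le> g k" for k
        using fink[of k] by (auto simp: g_def less_top)
      have sg: "summable g"
        using sum_fin g by (intro summable_suminf_not_top) auto
      have "(\<lambda>k. ennreal (suminf (\<lambda>j. g (j + k)))) \<longlonglongrightarrow> ennreal 0"
        by (intro tendsto_ennrealI suminf_exist_split2 sg)
      moreover have "suminf (\<lambda>j. ?H (R (j + k))) = ennreal (suminf (\<lambda>j. g (j + k)))" for k
        unfolding g(1) using g(2) sg by (intro suminf_ennreal2) (auto simp: summable_iff_shift)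
      ultimately show ?thesis by simp
    qed
    then have "(\<lambda>k. ?H T + suminf (\<lambda>j. ?H (R (j + k)))) \<longlonglongrightarrow> ?H T + 0"
      by (intro tendsto_add tendsto_const)
    then show ?thesis
      using le by (intro LIMSEQ_le_const) auto
  qed auto
qed

theorem emeasure_hausdorff_measure:
  fixes A :: "'a::metric_space set"
  assumes "A \<in> sets borel"
  shows "emeasure (hausdorff_measure s) A = hausdorff_outer s A"
proof -
  interpret P: sigma_algebra "UNIV :: 'a set" "Pow UNIV"
    by (rule sigma_algebra_Pow)
  define L where "L = lambda_system (UNIV :: 'a set) (Pow UNIV) (hausdorff_outer s)"
  have ms: "measure_space UNIV L (hausdorff_outer s)"
    unfolding L_def by (rule P.caratheodory_lemma[OF outer_measure_space_hausdorff])
  then have sa: "sigma_algebra UNIV L"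
    by (simp add: measure_space_def)
  have "Collect closed \<subseteq> L"
    by (simp add: hausdorff_outer_closed L_def P.lambda_system_eq[unfolded Pow_UNIV] subset_iff)
  then have sub: "sets borel \<subseteq> L"
    unfolding borel_eq_closed using sigma_algebra.sigma_sets_subset[OF sa] by auto
  have "countably_additive (sets (borel :: 'a measure)) (hausdorff_outer s)"
  proof (rule countably_additiveI)
    fix B :: "nat \<Rightarrow> 'a set"
    assume B: "range B \<subseteq> sets borel" "disjoint_family B" "(\<Union>i. B i) \<in> sets borel"
    have "range B \<subseteq> L" "(\<Union>i. B i) \<in> L"
      using B(1,3) sub by (blast, blast)
    with B(2) ms show "suminf (\<lambda>i. hausdorff_outer s (B i)) = hausdorff_outer s (\<Union>i. B i)"
      by (simp add: measure_space_def countably_additive_def)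
  qed
  moreover have "positive (sets (borel :: 'a measure)) (hausdorff_outer s)"
    by (simp add: positive_def)
  ultimately show ?thesis
    unfolding hausdorff_measure_def using assms sets.sigma_algebra_axioms[of "borel :: 'a measure"]
    by (intro emeasure_measure_of_sigma) simp_all
qed


text \<open>If all points coincide, the denominator is \<open>0\<close> and the quotient is \<open>0\<close> by convention.\<close>

definition menger_curvature :: "nat \<Rightarrow> (nat \<Rightarrow> point) \<Rightarrow> real"
  where "menger_curvature m x =
    measure (hausdorff_measure (m + 1)) (convex hull (x ` {..m + 1})) / diameter (x ` {..m + 1}) ^ (m + 2)"

text \<open>For \<open>l = m + 2\<close> no value of \<open>y\<close> is used, so the supremum is that of a constant family and has
  no effect.\<close>

definition menger_energy :: "nat \<Rightarrow> nat \<Rightarrow> real \<Rightarrow> point set \<Rightarrow> ennreal"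
  where "menger_energy m l p \<Sigma> =
    (\<integral>\<^sup>+ x \<in> tuples l \<Sigma>.
       (SUP y \<in> {l..m + 1} \<rightarrow> \<Sigma>.
          ennreal (menger_curvature m (\<lambda>i. if i < l then lookup x i else y i) powr p))
     \<partial>hausdorff_measure (m * l))"

definition grassmannian :: "nat \<Rightarrow> nat \<Rightarrow> point set set"
  where "grassmannian n m = {H. subspace H \<and> H \<subseteq> real_space n \<and> dim H = m}"

definition beta_number :: "nat \<Rightarrow> nat \<Rightarrow> point set \<Rightarrow> point \<Rightarrow> real \<Rightarrow> real"
  where "beta_number n m \<Sigma> x r =
    1 / r * (INF H \<in> grassmannian n m. SUP z \<in> \<Sigma> \<inter> cball x r. infdist z ((+) x ` H))"

end

theory Submission
  imports Defs
begin

text \<open>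
  Starting from \<open>x\<close>, choose points of \<open>\<Sigma> \<inter> cball x r\<close> greedily, each as far as possible from the affine
  plane through the previous ones.  The last distance \<open>h\<close> bounds \<open>r\<close> times the beta number.  The distances
  decrease, so after rescaling the coordinate axes the simplex is uniformly fat, and it stays fat when its
  vertices move by at most \<open>c h\<close>: its volume is at least a multiple of \<open>h ^ (m + 1)\<close>.  Letting \<open>l\<close> vertices
  vary over \<open>\<Sigma>\<close> near the chosen ones, Ahlfors regularity and a product inequality for Hausdorff measures
  bound the energy below by a multiple of \<open>A ^ l * h ^ (m * l) * (h ^ (m + 1) / r ^ (m + 2)) powr p\<close>.
  Since \<open>h \<le> r\<close>, this implies the claim.
\<close>

text \<open>The constant may not depend on \<open>n\<close>, and only a lower bound on the
  m-dimensional measure of \<Sigma> is given, so this measure may be infinite and Fubini is not at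
  hand; moreover, the energy integrates against a Hausdorff measure of the product, not against a
  product measure. Both difficulties are met by working with covers directly: the product inequality
  then loses only a factor depending on \<open>m\<close> and \<open>l\<close>. Volume is bounded
  below through the \<open>m + 1\<close> coordinates along the greedy directions alone, again
  without reference to \<open>n\<close>. The greedy choice makes the matrix of edge coordinates
  triangular, with every entry of column j bounded by the diagonal entry \<open>h j\<close>.
  Dividing column j by \<open>h j\<close> leaves a unit diagonal and entries at most 1, so the
  inverse is controlled by powers of 2; this is where the factor \<open>2 ^ s\<close> in the
  tolerance comes from. The energy bound yields the exponent (m+1)p + ml for h/r. It is at most
  \<kappa> = (p+ml)(m+1), and h/r \<le> 1 allows the passage to \<kappa>.\<close>

section \<open>Finite covers, Vitali selection and weighted covers of products\<close>

lemma hausdorff_pre_finite_cover: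
  fixes U :: "'i \<Rightarrow> 'a::metric_space set"
  assumes I: "finite I" and cov: "A \<subseteq> (\<Union>i\<in>I. U i)"
    and U: "\<And>i. i \<in> I \<Longrightarrow> bounded (U i) \<and> diameter (U i) \<le> \<delta>" and "0 \<le> \<delta>"
  shows "hausdorff_pre s \<delta> A \<le> (\<Sum>i\<in>I. hausdorff_weight s (U i))"
proof -
  obtain f where f: "bij_betw f {0..<card I} I"
    using ex_bij_betw_nat_finite[OF I] by blast
  define V where "V k = (if k < card I then U (f k) else {})" for k
  have fI: "f k \<in> I" if "k < card I" for k
    using f that by (auto simp: bij_betw_def)
  have "A \<subseteq> (\<Union>k. V k)"
  proof
    fix x assume "x \<in> A"
    then obtain i where i: "i \<in> I" "x \<in> U i" using cov by blast
    then obtain k where "k < card I" "f k = i"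
      using f unfolding bij_betw_def by (metis atLeastLessThan_iff imageE)
    with i show "x \<in> (\<Union>k. V k)" by (auto simp: V_def)
  qed
  then have "hausdorff_pre s \<delta> A \<le> suminf (\<lambda>k. hausdorff_weight s (V k))"
    unfolding hausdorff_pre_def using U fI \<open>0 \<le> \<delta>\<close> by (intro INF_lower) (auto simp: V_def)
  also have "\<dots> = (\<Sum>k\<in>{0..<card I}. hausdorff_weight s (V k))"
    by (rule suminf_finite) (auto simp: V_def hausdorff_weight_def)
  also have "\<dots> = (\<Sum>k\<in>{0..<card I}. hausdorff_weight s (U (f k)))"
    by (rule sum.cong) (auto simp: V_def)
  also have "\<dots> = (\<Sum>i\<in>I. hausdorff_weight s (U i))"
    by (rule sum.reindex_bij_betw[OF f])
  finally show ?thesis .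
qed

text \<open>An index with the largest \<open>d\<close> is kept, all sets meeting its set are
  discarded, and the rest is treated recursively. The sets are arbitrary; the relation between a
  discarded set and the one that it meets is what later places it in a neighbourhood of the
  latter.\<close>

lemma finite_vitali:
  fixes U :: "'i \<Rightarrow> 'a set" and d :: "'i \<Rightarrow> real"
  assumes "finite F"
  shows "\<exists>D\<subseteq>F. disjoint_family_on U D \<and>
    (\<forall>k\<in>F. U k \<noteq> {} \<longrightarrow> (\<exists>j\<in>D. U j \<inter> U k \<noteq> {} \<and> d k \<le> d j))"
  using assms
proof (induction F rule: finite_psubset_induct)
  case (psubset F)
  show ?case
  proof (cases "F = {}")
    case False
    have "Max (d ` F) \<in> d ` F" using psubset.hyps False by (intro Max_in) auto
    then obtain k0 where "k0 \<in> F" "d k0 = Max (d ` F)" by (metis imageE)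
    then have k0: "k0 \<in> F" "\<And>k. k \<in> F \<Longrightarrow> d k \<le> d k0"
      using psubset.hyps by auto
    define F' where "F' = {k \<in> F - {k0}. U k \<inter> U k0 = {}}"
    have "F' \<subset> F" using k0 by (auto simp: F'_def)
    from psubset.IH[OF this] obtain D where D: "D \<subseteq> F'" "disjoint_family_on U D"
      "\<And>k. k \<in> F' \<Longrightarrow> U k \<noteq> {} \<Longrightarrow> \<exists>j\<in>D. U j \<inter> U k \<noteq> {} \<and> d k \<le> d j"
      by blast
    show ?thesis
    proof (intro exI conjI ballI impI)
      show "insert k0 D \<subseteq> F" using D(1) k0 by (auto simp: F'_def)
      show "disjoint_family_on U (insert k0 D)"
        using D(1,2) unfolding disjoint_family_on_def F'_def by blast
      fix k assume k: "k \<in> F" "U k \<noteq> {}"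
      show "\<exists>j\<in>insert k0 D. U j \<inter> U k \<noteq> {} \<and> d k \<le> d j"
      proof (cases "k \<in> F'")
        case True
        then show ?thesis using D(3) k by blast
      next
        case False
        then have "U k0 \<inter> U k \<noteq> {}" using k by (auto simp: F'_def)
        then show ?thesis using k0 k by blast
      qed
    qed
  qed (auto simp: disjoint_family_on_def)
qed

text \<open>A Vitali subfamily consisting of sets of positive weight is disjoint, so lowering its weights by
  their minimum \<open>t\<close> lowers the covering multiplicity by at most \<open>t\<close>, and at least one weight vanishes.\<close>

lemma weighted_cover:
  fixes U :: "'i \<Rightarrow> 'a::metric_space set" and d w :: "'i \<Rightarrow> real"
  assumes F: "finite F"
    and U: "\<And>k. k \<in> F \<Longrightarrow> bounded (U k) \<and> diameter (U k) \<le> d k"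
    and M: "0 \<le> M" "\<And>D. D \<subseteq> F \<Longrightarrow> S \<subseteq> (\<Union>k\<in>D. \<Union>u\<in>U k. cball u (d k)) \<Longrightarrow> M \<le> (\<Sum>k\<in>D. d k ^ s)"
    and w: "\<And>k. k \<in> F \<Longrightarrow> 0 \<le> w k"
    and cov: "\<And>a. a \<in> S \<Longrightarrow> \<theta> \<le> (\<Sum>k\<in>F. if a \<in> U k then w k else 0)"
  shows "\<theta> * M \<le> (\<Sum>k\<in>F. w k * d k ^ s)"
proof -
  have d0: "0 \<le> d k" if "k \<in> F" for k
    using U[OF that] diameter_ge_0[of "U k"] by linarith
  show ?thesis
    using w cov
  \<comment> \<open>The level \<theta> must vary as well: every round lowers it by \<open>t\<close>,
    possibly below 0, where the claim is trivial.\<close>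
  proof (induction "card {k\<in>F. 0 < w k}" arbitrary: w \<theta> rule: less_induct)
    case less
    have nonneg: "0 \<le> (\<Sum>k\<in>F. w k * d k ^ s)"
      using less.prems(1) d0 by (intro sum_nonneg) auto
    show ?case
    proof (cases "\<theta> \<le> 0")
      case True
      then have "\<theta> * M \<le> 0" using M(1) by (simp add: mult_nonpos_nonneg)
      then show ?thesis using nonneg by linarith
    next
      case False
      define G where "G = {k\<in>F. 0 < w k}"
      have "finite G" using F by (simp add: G_def)
      from finite_vitali[OF this, of U d] obtain D where D: "D \<subseteq> G" "disjoint_family_on U D"
        "\<And>k. k \<in> G \<Longrightarrow> U k \<noteq> {} \<Longrightarrow> \<exists>j\<in>D. U j \<inter> U k \<noteq> {} \<and> d k \<le> d j"
        by blast
      have DF: "D \<subseteq> F" using D(1) by (auto simp: G_def)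
      \<comment> \<open>As \<theta> > 0, every \<open>a\<close> in \<open>S\<close> lies in some
        \<open>U k\<close> of positive weight. A selected \<open>U j\<close> meets it in some
        \<open>y\<close>, and the distance from \<open>y\<close> to \<open>a\<close> is at most
        \<open>d k\<close>, hence at most \<open>d j\<close>.\<close>
      have "S \<subseteq> (\<Union>k\<in>D. \<Union>u\<in>U k. cball u (d k))"
      proof
        fix a assume a: "a \<in> S"
        have "\<exists>k\<in>G. a \<in> U k"
        proof (rule ccontr)
          assume "\<not> ?thesis"
          then have "(\<Sum>k\<in>F. if a \<in> U k then w k else 0) = 0"
            using less.prems(1) by (intro sum.neutral) (force simp: G_def)
          with less.prems(2)[OF a] False show False by simp
        qed
        then obtain k where k: "k \<in> G" "a \<in> U k" by blast
        then obtain j y where j: "j \<in> D" "y \<in> U j" "y \<in> U k" "d k \<le> d j" using D(3) by blast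
        have "dist y a \<le> diameter (U k)"
          using U[of k] k j by (intro diameter_bounded_bound) (auto simp: G_def)
        then have "dist y a \<le> d j" using U[of k] k j by (auto simp: G_def)
        then show "a \<in> (\<Union>k\<in>D. \<Union>u\<in>U k. cball u (d k))" using j by (auto simp: mem_cball)
      qed
      from M(2)[OF DF this] have MD: "M \<le> (\<Sum>k\<in>D. d k ^ s)" .
      show ?thesis
      proof (cases "D = {}")
        case True
        then have "M = 0" using MD M(1) by simp
        then show ?thesis using nonneg by simp
      next
        case ne: False
        have fD: "finite D" using DF F finite_subset by blast
        define t where "t = Min (w ` D)"
        have t_le: "t \<le> w k" if "k \<in> D" for k
          using that fD by (simp add: t_def)
        have "t \<in> w ` D" unfolding t_def using fD ne by (intro Min_in) auto
        then obtain k0 where k0: "k0 \<in> D" "w k0 = t" by blast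
        then have t0: "0 < t" using D(1) by (auto simp: G_def)
        define w' where "w' k = (if k \<in> D then w k - t else w k)" for k
        have w'0: "0 \<le> w' k" if "k \<in> F" for k
          using less.prems(1)[OF that] t_le by (auto simp: w'_def)
        have "{k\<in>F. 0 < w' k} \<subset> {k\<in>F. 0 < w k}"
          using k0 t0 DF by (auto simp: w'_def split: if_splits)
        then have card: "card {k\<in>F. 0 < w' k} < card {k\<in>F. 0 < w k}"
          using F by (intro psubset_card_mono) auto
        have cov': "\<theta> - t \<le> (\<Sum>k\<in>F. if a \<in> U k then w' k else 0)" if a: "a \<in> S" for a
        proof -
          have "(\<Sum>k\<in>F. if a \<in> U k then w k else 0) - (\<Sum>k\<in>F. if a \<in> U k then w' k else 0)
              = (\<Sum>k\<in>F. if k \<in> {k\<in>D. a \<in> U k} then t else 0)"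
            unfolding sum_subtractf[symmetric] by (intro sum.cong) (auto simp: w'_def)
          also have "\<dots> = real (card {k\<in>D. a \<in> U k}) * t"
            using F DF by (subst sum.inter_restrict[symmetric])
              (auto simp: Int_absorb1 subset_iff intro!: arg_cong[where f=card])
          also have "\<dots> \<le> 1 * t"
          proof -
            have "card {k\<in>D. a \<in> U k} \<le> 1"
              using D(2) fD by (subst One_nat_def, subst card_le_Suc0_iff_eq)
                (auto simp: disjoint_family_on_def)
            then show ?thesis using t0 by (intro mult_right_mono) auto
          qed
          finally show ?thesis using less.prems(2)[OF a] by simp
        qed
        have 1: "(\<theta> - t) * M \<le> (\<Sum>k\<in>F. w' k * d k ^ s)"
          using card w'0 cov' by (intro less.hyps) auto
        have 2: "t * M \<le> t * (\<Sum>k\<in>D. d k ^ s)"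
          using MD t0 by simp
        have "(\<Sum>k\<in>F. w k * d k ^ s) = (\<Sum>k\<in>F. w' k * d k ^ s + (if k \<in> D then t * d k ^ s else 0))"
          by (intro sum.cong) (auto simp: w'_def algebra_simps)
        also have "\<dots> = (\<Sum>k\<in>F. w' k * d k ^ s) + t * (\<Sum>k\<in>D. d k ^ s)"
          using F DF by (simp add: sum.distrib sum.inter_restrict[symmetric] Int_absorb1 sum_distrib_left)
        finally show ?thesis using 1 2 by (simp add: algebra_simps)
      qed
    qed
  qed
qed

text \<open>Weights are what makes the induction on \<open>l\<close> close. The bound for the first
  \<open>l\<close> factors, applied to the indices whose last set contains a given \<open>b\<close>,
  says that the weights \<open>w k * d k ^ (s * l)\<close> cover the last factor with multiplicity
  at least the product of the first \<open>l\<close> values of \<open>M\<close>;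
  \<open>weighted_cover\<close> then contributes the last value.\<close>

lemma weighted_product_cover:
  fixes U :: "'i \<Rightarrow> nat \<Rightarrow> 'a::metric_space set" and d w :: "'i \<Rightarrow> real"
  assumes F: "finite F"
    and U: "\<And>k i. k \<in> F \<Longrightarrow> i < l \<Longrightarrow> bounded (U k i) \<and> diameter (U k i) \<le> d k"
    and M: "\<And>i. i < l \<Longrightarrow> 0 \<le> M i"
      "\<And>i D. i < l \<Longrightarrow> D \<subseteq> F \<Longrightarrow> S i \<subseteq> (\<Union>k\<in>D. \<Union>u\<in>U k i. cball u (d k)) \<Longrightarrow> M i \<le> (\<Sum>k\<in>D. d k ^ s)"
    and w: "\<And>k. k \<in> F \<Longrightarrow> 0 \<le> w k"
    and cov: "\<And>a. (\<And>i. i < l \<Longrightarrow> a i \<in> S i) \<Longrightarrow>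
      1 \<le> (\<Sum>k\<in>F. if \<forall>i<l. a i \<in> U k i then w k else 0)"
  shows "(\<Prod>i<l. M i) \<le> (\<Sum>k\<in>F. w k * d k ^ (s * l))"
  using U M w cov
proof (induction l arbitrary: w)
  case 0
  from "0.prems"(5)[of undefined] show ?case by simp
next
  case (Suc l)
  have "(\<Prod>i<l. M i) * M l \<le> (\<Sum>k\<in>F. (w k * d k ^ (s * l)) * d k ^ s)"
  proof (rule weighted_cover[OF F, where U = "\<lambda>k. U k l" and S = "S l"])
    fix k assume k: "k \<in> F"
    show "bounded (U k l) \<and> diameter (U k l) \<le> d k" using Suc.prems(1)[OF k] by simp
    then have "0 \<le> d k" using diameter_ge_0[of "U k l"] by linarith
    then show "0 \<le> w k * d k ^ (s * l)" using Suc.prems(4)[OF k] by simp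
  next
    fix b assume b: "b \<in> S l"
    \<comment> \<open>Setting the weights of the indices with \<open>b\<close> outside
      \<open>U k l\<close> to 0 keeps the index set \<open>F\<close> fixed.\<close>
    have "(\<Prod>i<l. M i) \<le> (\<Sum>k\<in>F. (if b \<in> U k l then w k else 0) * d k ^ (s * l))"
    proof (rule Suc.IH)
      fix a assume a: "\<And>i. i < l \<Longrightarrow> a i \<in> S i"
      have "1 \<le> (\<Sum>k\<in>F. if \<forall>i<Suc l. (a(l := b)) i \<in> U k i then w k else 0)"
        using a b by (intro Suc.prems(5)) (auto simp: less_Suc_eq)
      also have "\<dots> = (\<Sum>k\<in>F. if \<forall>i<l. a i \<in> U k i then if b \<in> U k l then w k else 0 else 0)"
        by (intro sum.cong) (auto simp: less_Suc_eq)
      finally show "1 \<le> (\<Sum>k\<in>F. if \<forall>i<l. a i \<in> U k i then if b \<in> U k l then w k else 0 else 0)" .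
    qed (use Suc.prems in auto)
    also have "\<dots> = (\<Sum>k\<in>F. if b \<in> U k l then w k * d k ^ (s * l) else 0)"
      by (intro sum.cong) auto
    finally show "(\<Prod>i<l. M i) \<le> (\<Sum>k\<in>F. if b \<in> U k l then w k * d k ^ (s * l) else 0)" .
  qed (use Suc.prems in auto)
  then show ?case by (simp add: mult.assoc power_add[symmetric] add.commute)
qed

section \<open>Coordinates and compact products in the space of finitely supported families\<close>

lemma norm_lookup_le: "norm (lookup x i) \<le> norm (x :: 'i \<Rightarrow>\<^sub>0 'a::real_inner)"
proof (cases "i \<in> keys x")
  case True
  have "lookup x i \<bullet> lookup x i \<le> (\<Sum>i\<in>keys x. lookup x i \<bullet> lookup x i)"
    using True by (intro member_le_sum) auto
  then have "(norm (lookup x i))\<^sup>2 \<le> (norm x)\<^sup>2"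
    by (simp add: power2_norm_eq_inner inner_poly_mapping_def)
  then show ?thesis by (rule power2_le_imp_le) simp
qed (simp add: in_keys_iff)

lemma dist_lookup_le: "dist (lookup x i) (lookup y i) \<le> dist x (y :: 'i \<Rightarrow>\<^sub>0 'a::real_inner)"
  using norm_lookup_le[of "x - y" i] by (simp add: dist_norm lookup_minus)

lemma lookup_image_diameter:
  fixes A :: "('i \<Rightarrow>\<^sub>0 'a::real_inner) set"
  assumes A: "bounded A"
  shows "bounded ((\<lambda>X. lookup X i) ` A)" "diameter ((\<lambda>X. lookup X i) ` A) \<le> diameter A"
proof -
  have *: "dist u v \<le> diameter A"
    if "u \<in> (\<lambda>X. lookup X i) ` A" "v \<in> (\<lambda>X. lookup X i) ` A" for u v
  proof -
    from that obtain x y where "x \<in> A" "u = lookup x i" "y \<in> A" "v = lookup y i" by blast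
    then show ?thesis
      using dist_lookup_le[of x i y] diameter_bounded_bound[OF A, of x y] by simp
  qed
  show "bounded ((\<lambda>X. lookup X i) ` A)" unfolding bounded_two_points using * by blast
  show "diameter ((\<lambda>X. lookup X i) ` A) \<le> diameter A"
    using * diameter_ge_0[OF A] by (intro diameter_le) (auto simp: dist_norm)
qed

lemma norm_single: "norm (Poly_Mapping.single i (y :: 'a::real_inner)) = norm y"
  unfolding norm_poly_mapping_def inner_poly_mapping_def
  by (cases "y = 0") (auto simp: norm_eq_sqrt_inner)

lemma continuous_on_single:
  "continuous_on A (\<lambda>y :: 'a::real_inner. Poly_Mapping.single i y)"
  unfolding continuous_on_iff
  by (auto simp: dist_norm norm_single simp flip: single_diff)

text \<open>The version of \<open>tuples\<close> with a separate set for each factor, since each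
  varying vertex stays near a point of its own.\<close>

definition product_tuples :: "nat \<Rightarrow> (nat \<Rightarrow> 'a::zero set) \<Rightarrow> (nat \<Rightarrow>\<^sub>0 'a) set"
  where "product_tuples l S = {X. (\<forall>i<l. lookup X i \<in> S i) \<and> (\<forall>i\<ge>l. lookup X i = 0)}"

text \<open>Splitting off the last coordinate with \<open>Poly_Mapping.single\<close> exhibits the
  set as a continuous image of a product of two compact sets.\<close>

lemma compact_product_tuples:
  fixes S :: "nat \<Rightarrow> 'a::real_inner set"
  assumes "\<And>i. i < l \<Longrightarrow> compact (S i)"
  shows "compact (product_tuples l S)"
  using assms
proof (induction l)
  case 0
  have "product_tuples 0 S = {0}"
    by (auto simp: product_tuples_def intro!: poly_mapping_eqI)
  then show ?case by simp
next
  case (Suc l)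
  have eq: "product_tuples (Suc l) S
      = (\<lambda>(X, y). X + Poly_Mapping.single l y) ` (product_tuples l S \<times> S l)" (is "_ = ?f ` ?P")
  proof (intro equalityI subsetI)
    fix X assume X: "X \<in> product_tuples (Suc l) S"
    let ?y = "lookup X l" and ?X = "X - Poly_Mapping.single l (lookup X l)"
    have "?X \<in> product_tuples l S" "?y \<in> S l"
      using X by (auto simp: product_tuples_def lookup_minus lookup_single when_def less_Suc_eq)
    moreover have "X = ?X + Poly_Mapping.single l ?y" by simp
    ultimately show "X \<in> ?f ` ?P" by (intro image_eqI[of _ _ "(?X, ?y)"]) auto
  qed (auto simp: product_tuples_def lookup_add lookup_single when_def less_Suc_eq)
  have "continuous_on ?P (\<lambda>z. fst z + Poly_Mapping.single l (snd z))"
    by (intro continuous_intros continuous_on_compose2[OF continuous_on_single[of UNIV]]) auto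
  moreover have "compact ?P" using Suc by (intro compact_Times) auto
  ultimately show ?case unfolding eq case_prod_beta by (rule compact_continuous_image)
qed

section \<open>The product inequality for Hausdorff measures\<close>

lemma hausdorff_outer_gt_pre:
  assumes "b < hausdorff_outer s A"
  obtains \<delta> where "0 < \<delta>" "b < hausdorff_pre s \<delta> A"
  using assms unfolding hausdorff_outer_def less_SUP_iff by auto

lemma diameter_enlarge:
  fixes A :: "'a::real_normed_vector set"
  assumes A: "bounded A" and r: "0 \<le> r"
  shows "bounded (\<Union>a\<in>A. cball a r)" "diameter (\<Union>a\<in>A. cball a r) \<le> diameter A + 2 * r"
proof -
  have *: "dist u v \<le> diameter A + 2 * r"
    if uv: "u \<in> (\<Union>a\<in>A. cball a r)" "v \<in> (\<Union>a\<in>A. cball a r)" for u v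
  proof -
    from uv obtain a b where "a \<in> A" "dist a u \<le> r" "b \<in> A" "dist b v \<le> r" by auto
    then show ?thesis
      using diameter_bounded_bound[OF A, of a b] dist_triangle[of u v a] dist_triangle[of a v b]
      by (simp add: dist_commute)
  qed
  show "bounded (\<Union>a\<in>A. cball a r)" unfolding bounded_two_points using * by blast
  have "diameter A + 2 * r \<ge> 0" using diameter_ge_0[OF A] r by simp
  then show "diameter (\<Union>a\<in>A. cball a r) \<le> diameter A + 2 * r"
    using * by (intro diameter_le) (simp_all add: dist_norm)
qed

lemma power_add_le_two_power:
  fixes a b :: real
  assumes "0 \<le> a" "0 \<le> b"
  shows "(a + b) ^ s \<le> 2 ^ s * (a ^ s + b ^ s)"
proof -
  have "(a + b) ^ s \<le> (2 * max a b) ^ s" using assms by (intro power_mono) auto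
  also have "\<dots> = 2 ^ s * max a b ^ s" by (simp add: power_mult_distrib)
  also have "\<dots> \<le> 2 ^ s * (a ^ s + b ^ s)"
    using assms by (intro mult_left_mono) (auto simp: max_def)
  finally show ?thesis .
qed

text \<open>A cover of the product by sets \<open>W k\<close> gives, for fixed \<open>a\<close>, a cover of the remaining factors by
  those \<open>W k\<close> whose projection contains \<open>a\<close>; iterating, every factor gets covered with weights.\<close>

lemma hausdorff_outer_product:
  fixes S :: "nat \<Rightarrow> 'a::real_inner set" and M :: real
  assumes s: "1 \<le> s" and l: "1 \<le> l" and M: "0 < M"
    and S: "\<And>i. i < l \<Longrightarrow> compact (S i)" "\<And>i. i < l \<Longrightarrow> ennreal M < hausdorff_outer s (S i)"
  shows "ennreal (unit_ball_vol (s * l) / 4 ^ (s * l) * (M / (unit_ball_vol s * (3 / 2) ^ s)) ^ l)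
    \<le> hausdorff_outer (s * l) (product_tuples l S)"
proof -
  define \<omega> where "\<omega> = unit_ball_vol (real (s * l))"
  define \<nu> where "\<nu> = unit_ball_vol (real s)"
  have pos: "0 < \<omega>" "0 < \<nu>" by (auto simp: \<omega>_def \<nu>_def)
  have sl: "1 \<le> s * l" using s l by simp
  \<comment> \<open>The strict inequality for \<open>M\<close> is used here: the supremum over
    scales already exceeds \<open>M\<close> at one scale, even if the measure of \<open>S i\<close>
    is infinite.\<close>
  have "\<exists>\<delta>>0. ennreal M < hausdorff_pre s \<delta> (S i)" if "i < l" for i
    using hausdorff_outer_gt_pre[OF S(2)[OF that]] by blast
  then obtain \<delta>s where \<delta>s: "\<And>i. i < l \<Longrightarrow> 0 < \<delta>s i \<and> ennreal M < hausdorff_pre s (\<delta>s i) (S i)"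
    by metis
  \<comment> \<open>The sets that cover a factor are projections of diameter at most
    \<open>d k\<close> enlarged by \<open>d k\<close>, hence of diameter at most
    \<open>3 * d k\<close>. This accounts for the 3 here and for \<open>3 / 2\<close> in the
    constant.\<close>
  define \<delta> where "\<delta> = Min (\<delta>s ` {..<l}) / 3"
  have ne: "\<delta>s ` {..<l} \<noteq> {}" using l by (simp add: lessThan_empty_iff)
  have \<delta>: "0 < \<delta>" using \<delta>s ne by (simp add: \<delta>_def)
  have pre: "ennreal M \<le> hausdorff_pre s (3 * \<delta>) (S i)" if "i < l" for i
  proof -
    have "3 * \<delta> \<le> \<delta>s i" using that by (simp add: \<delta>_def)
    from hausdorff_pre_antimono[OF this, of s "S i"] \<delta>s[OF that] show ?thesis by auto
  qed
  have "ennreal (\<omega> / 4 ^ (s * l) * (M / (\<nu> * (3 / 2) ^ s)) ^ l) \<le> hausdorff_pre (s * l) (\<delta> / 2) (product_tuples l S)"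
    unfolding hausdorff_pre_def
  proof (rule INF_greatest, clarify)
    fix W :: "nat \<Rightarrow> (nat \<Rightarrow>\<^sub>0 'a) set"
    assume cov: "product_tuples l S \<subseteq> (\<Union>k. W k)"
      and W: "\<forall>k. bounded (W k) \<and> diameter (W k) \<le> \<delta> / 2"
    show "ennreal (\<omega> / 4 ^ (s * l) * (M / (\<nu> * (3 / 2) ^ s)) ^ l) \<le> suminf (\<lambda>k. hausdorff_weight (s * l) (W k))"
    proof (rule ennreal_le_epsilon)
      fix e :: real assume e: "0 < e"
      \<comment> \<open>Covering sets are thickened to open ones so that compactness gives a finite
        subcover. The first bound keeps \<open>d k\<close> below \<delta>, the second gives
        \<open>\<eta> k ^ (s * l) \<le> \<eta> k\<close>, and the third makes the total cost of
        thickening at most \<open>e\<close>.\<close>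
      define \<eta> where "\<eta> k = min (\<delta> / 2) (min 1 (e * 2 ^ (s * l) / \<omega> * (1 / 2) ^ Suc k))" for k
      have \<eta>: "0 < \<eta> k" "\<eta> k \<le> \<delta> / 2" "\<eta> k \<le> 1" "\<eta> k \<le> e * 2 ^ (s * l) / \<omega> * (1 / 2) ^ Suc k" for k
        using \<delta> e pos by (auto simp: \<eta>_def)
      define V where "V k = (\<Union>w\<in>W k. ball w (\<eta> k / 2))" for k
      define d where "d k = diameter (W k) + \<eta> k" for k
      have dW: "0 \<le> diameter (W k)" for k using W by (intro diameter_ge_0) auto
      have d: "0 < d k" "d k \<le> \<delta>" for k
        using dW[of k] \<eta>[of k] W[rule_format, of k] by (auto simp: d_def)
      have V: "bounded (V k)" "diameter (V k) \<le> d k" for k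
      proof -
        let ?E = "\<Union>a\<in>W k. cball a (\<eta> k / 2)"
        have sub: "V k \<subseteq> ?E" by (auto simp: V_def)
        have E: "bounded ?E" "diameter ?E \<le> diameter (W k) + 2 * (\<eta> k / 2)"
          using W \<eta>(1)[of k] by (intro diameter_enlarge; simp)+
        show "bounded (V k)" using E(1) sub bounded_subset by blast
        show "diameter (V k) \<le> d k" using diameter_subset[OF sub E(1)] E(2) by (simp add: d_def)
      qed
      have WV: "W k \<subseteq> V k" for k using \<eta>(1)[of k] by (force simp: V_def)
      have opn: "open (V k)" for k by (auto simp: V_def)
      have "product_tuples l S \<subseteq> (\<Union>k\<in>UNIV. V k)" using cov WV by blast
      moreover have "compact (product_tuples l S)" using S(1) by (rule compact_product_tuples)
      ultimately obtain F where F: "finite F" "product_tuples l S \<subseteq> (\<Union>k\<in>F. V k)"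
        using opn by (metis compactE_image)
      have "(\<Prod>i<l. M / (\<nu> * (3 / 2) ^ s)) \<le> (\<Sum>k\<in>F. 1 * d k ^ (s * l))"
      proof (rule weighted_product_cover[OF F(1), where S = S and U = "\<lambda>k i. (\<lambda>X. lookup X i) ` V k"])
        fix k i
        show "bounded ((\<lambda>X. lookup X i) ` V k) \<and> diameter ((\<lambda>X. lookup X i) ` V k) \<le> d k"
          using lookup_image_diameter[OF V(1)[of k], of i] V(2)[of k] by linarith
      next
        fix i D
        assume i: "i < l" and D: "D \<subseteq> F"
          and c: "S i \<subseteq> (\<Union>k\<in>D. \<Union>u\<in>(\<lambda>X. lookup X i) ` V k. cball u (d k))"
        have fD: "finite D" using D F(1) finite_subset by blast
        let ?U = "\<lambda>k. \<Union>u\<in>(\<lambda>X. lookup X i) ` V k. cball u (d k)"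
        have U: "bounded (?U k)" "diameter (?U k) \<le> 3 * d k" for k
          using diameter_enlarge[OF lookup_image_diameter(1)[OF V(1)], of "d k" i k] d[of k]
            lookup_image_diameter(2)[OF V(1)[of k], of i] V(2)[of k] by (simp, linarith)
        have "ennreal M \<le> hausdorff_pre s (3 * \<delta>) (S i)" by (rule pre[OF i])
        also have "\<dots> \<le> (\<Sum>k\<in>D. hausdorff_weight s (?U k))"
        proof (rule hausdorff_pre_finite_cover[OF fD c])
          fix k
          have "diameter (?U k) \<le> 3 * \<delta>" using U(2)[of k] d(2)[of k] by linarith
          then show "bounded (?U k) \<and> diameter (?U k) \<le> 3 * \<delta>" using U(1) by blast
        qed (use \<delta> in simp)
        also have "\<dots> \<le> (\<Sum>k\<in>D. ennreal (\<nu> * (3 / 2) ^ s * d k ^ s))"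
        proof (rule sum_mono)
          fix k
          have "(diameter (?U k) / 2) ^ s \<le> (3 / 2 * d k) ^ s"
            using U[of k] diameter_ge_0[OF U(1)[of k]] by (intro power_mono) auto
          then show "hausdorff_weight s (?U k) \<le> ennreal (\<nu> * (3 / 2) ^ s * d k ^ s)"
            using pos unfolding hausdorff_weight_def \<nu>_def
            by (auto simp: power_mult_distrib[symmetric] mult.assoc intro!: ennreal_leI mult_left_mono)
        qed
        also have "\<dots> = ennreal (\<Sum>k\<in>D. \<nu> * (3 / 2) ^ s * d k ^ s)"
          using pos d(1) by (intro sum_ennreal) (simp add: less_imp_le)
        finally have "M \<le> (\<Sum>k\<in>D. \<nu> * (3 / 2) ^ s * d k ^ s)"
          using pos d(1) by (subst (asm) ennreal_le_iff) (auto intro!: sum_nonneg simp: less_imp_le)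
        then show "M / (\<nu> * (3 / 2) ^ s) \<le> (\<Sum>k\<in>D. d k ^ s)"
          using pos by (subst pos_divide_le_eq) (auto simp: sum_distrib_right mult.commute)
      next
        fix a :: "nat \<Rightarrow> 'a" assume a: "\<And>i. i < l \<Longrightarrow> a i \<in> S i"
        have fin: "finite {i. (a i when i < l) \<noteq> 0}" by (rule finite_subset[of _ "{..<l}"]) auto
        define X where "X = Abs_poly_mapping (\<lambda>i. a i when i < l)"
        have X: "lookup X i = (a i when i < l)" for i
          unfolding X_def using fin by (simp add: Abs_poly_mapping_inverse)
        have "X \<in> product_tuples l S" using a by (auto simp: product_tuples_def X)
        then obtain k where k: "k \<in> F" "X \<in> V k" using F(2) by blast
        have "\<forall>i<l. a i \<in> (\<lambda>X. lookup X i) ` V k"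
        proof (intro allI impI)
          fix i assume "i < l"
          then show "a i \<in> (\<lambda>X. lookup X i) ` V k" using k(2) by (intro image_eqI[of _ _ X]) (auto simp: X)
        qed
        then have "1 \<le> (if \<forall>i<l. a i \<in> (\<lambda>X. lookup X i) ` V k then 1 else 0 :: real)" by simp
        also have "\<dots> \<le> (\<Sum>k\<in>F. if \<forall>i<l. a i \<in> (\<lambda>X. lookup X i) ` V k then 1 else 0 :: real)"
          using k(1) F(1) by (intro member_le_sum[where f = "\<lambda>k. if \<forall>i<l. a i \<in> (\<lambda>X. lookup X i) ` V k then 1 else 0"]) auto
        finally show "1 \<le> (\<Sum>k\<in>F. if \<forall>i<l. a i \<in> (\<lambda>X. lookup X i) ` V k then 1 else 0 :: real)" .
      qed (use M pos in auto)
      then have "\<omega> / 4 ^ (s * l) * (M / (\<nu> * (3 / 2) ^ s)) ^ l \<le> \<omega> / 4 ^ (s * l) * (\<Sum>k\<in>F. d k ^ (s * l))"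
        using pos by (intro mult_left_mono) auto
      also have "\<dots> = (\<Sum>k\<in>F. \<omega> / 4 ^ (s * l) * d k ^ (s * l))" by (simp add: sum_distrib_left)
      also have "\<dots> \<le> (\<Sum>k\<in>F. \<omega> * (diameter (W k) / 2) ^ (s * l) + e * (1 / 2) ^ Suc k)"
      proof (rule sum_mono)
        fix k
        \<comment> \<open>Separating the thickening costs \<open>2 ^ (s * l)\<close>; the halved
          diameter in the Hausdorff weight costs the same again, whence
          \<open>4 ^ (s * l)\<close>.\<close>
        have "d k ^ (s * l) \<le> 2 ^ (s * l) * (diameter (W k) ^ (s * l) + \<eta> k ^ (s * l))"
          unfolding d_def using dW \<eta>(1)[of k] by (intro power_add_le_two_power) auto
        then have "\<omega> / 4 ^ (s * l) * d k ^ (s * l)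
            \<le> \<omega> / 4 ^ (s * l) * (2 ^ (s * l) * (diameter (W k) ^ (s * l) + \<eta> k ^ (s * l)))"
          using pos by (intro mult_left_mono) auto
        also have "\<dots> = \<omega> * (diameter (W k) / 2) ^ (s * l) + \<omega> / 2 ^ (s * l) * \<eta> k ^ (s * l)"
        proof -
          have "(4::real) ^ (s * l) = 2 ^ (s * l) * 2 ^ (s * l)" by (simp flip: power_mult_distrib)
          then show ?thesis by (simp add: field_simps)
        qed
        also have "\<omega> / 2 ^ (s * l) * \<eta> k ^ (s * l) \<le> \<omega> / 2 ^ (s * l) * (e * 2 ^ (s * l) / \<omega> * (1 / 2) ^ Suc k)"
        proof -
          have "\<eta> k ^ (s * l) \<le> \<eta> k ^ 1"
            using sl \<eta>[of k] by (intro power_decreasing) auto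
          with \<eta>(4)[of k] show ?thesis using pos by (intro mult_left_mono) auto
        qed
        also have "\<dots> = e * (1 / 2) ^ Suc k" using pos by simp
        finally show "\<omega> / 4 ^ (s * l) * d k ^ (s * l)
            \<le> \<omega> * (diameter (W k) / 2) ^ (s * l) + e * (1 / 2) ^ Suc k" by simp
      qed
      also have "\<dots> = (\<Sum>k\<in>F. \<omega> * (diameter (W k) / 2) ^ (s * l)) + (\<Sum>k\<in>F. e * (1 / 2) ^ Suc k)"
        by (rule sum.distrib)
      also have "(\<Sum>k\<in>F. e * (1 / 2) ^ Suc k) \<le> e"
        using sum_le_suminf[OF sums_summable[OF sums_mult[OF power_half_series, of e]] F(1)]
          sums_unique[OF sums_mult[OF power_half_series, of e]] e by simp
      finally have "\<omega> / 4 ^ (s * l) * (M / (\<nu> * (3 / 2) ^ s)) ^ l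
          \<le> (\<Sum>k\<in>F. \<omega> * (diameter (W k) / 2) ^ (s * l)) + e" by simp
      then have "ennreal (\<omega> / 4 ^ (s * l) * (M / (\<nu> * (3 / 2) ^ s)) ^ l)
          \<le> ennreal (\<Sum>k\<in>F. \<omega> * (diameter (W k) / 2) ^ (s * l)) + ennreal e"
        using pos dW e by (subst ennreal_plus[symmetric]) (auto intro!: sum_nonneg ennreal_leI)
      also have "ennreal (\<Sum>k\<in>F. \<omega> * (diameter (W k) / 2) ^ (s * l))
          = (\<Sum>k\<in>F. ennreal (\<omega> * (diameter (W k) / 2) ^ (s * l)))"
        using pos dW by (intro sum_ennreal[symmetric]) auto
      \<comment> \<open>For empty \<open>W k\<close> both sides vanish because \<open>s * l\<close>
        is positive and the diameter is 0.\<close>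
      also have "\<dots> = (\<Sum>k\<in>F. hausdorff_weight (s * l) (W k))"
        using sl by (intro sum.cong) (auto simp: hausdorff_weight_def \<omega>_def)
      also have "\<dots> \<le> suminf (\<lambda>k. hausdorff_weight (s * l) (W k))"
        using F(1) by (intro sum_le_suminf) auto
      finally show "ennreal (\<omega> / 4 ^ (s * l) * (M / (\<nu> * (3 / 2) ^ s)) ^ l)
          \<le> suminf (\<lambda>k. hausdorff_weight (s * l) (W k)) + ennreal e"
        by (simp add: add_right_mono)
    qed
  qed
  also have "\<dots> \<le> hausdorff_outer (s * l) (product_tuples l S)"
    using \<delta> by (intro hausdorff_pre_le_outer) simp
  finally show ?thesis by (simp add: \<omega>_def \<nu>_def)
qed

section \<open>Upper and lower bounds for the Hausdorff measure of simplices\<close>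

text \<open>\<open>menger_curvature\<close> uses the real-valued \<open>measure\<close>, which is 0
  on sets of infinite measure, so a lower bound on volume is of use only together with finiteness.
  The simplex lies in the parallelepiped \<open>T\<close> spanned by its edges at
  \<open>X s\<close>, and \<open>T\<close> is cut into small cells of a grid.\<close>

lemma hausdorff_outer_convex_hull_finite:
  fixes X :: "nat \<Rightarrow> 'a::real_normed_vector"
  shows "hausdorff_outer s (convex hull (X ` {..s})) < top"
proof -
  define L where "L = (\<Sum>i<s. norm (X i - X s))"
  have L: "0 \<le> L" by (auto simp: L_def intro: sum_nonneg)
  define f where "f t = X s + (\<Sum>i<s. t i *\<^sub>R (X i - X s))" for t :: "nat \<Rightarrow> real"
  define T where "T = f ` {t. \<forall>i<s. 0 \<le> t i \<and> t i \<le> 1}"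
  have "convex T"
  proof (rule convexI)
    fix y z :: 'a and u v :: real assume yz: "y \<in> T" "z \<in> T" and uv: "0 \<le> u" "0 \<le> v" "u + v = 1"
    then obtain t r where t: "\<forall>i<s. 0 \<le> t i \<and> t i \<le> 1" "y = f t" and r: "\<forall>i<s. 0 \<le> r i \<and> r i \<le> 1" "z = f r"
      by (auto simp: T_def)
    have "u *\<^sub>R y + v *\<^sub>R z = f (\<lambda>i. u * t i + v * r i)"
    proof -
      have "u *\<^sub>R f t + v *\<^sub>R f r = (u + v) *\<^sub>R X s + (\<Sum>i<s. (u * t i + v * r i) *\<^sub>R (X i - X s))"
        unfolding f_def
        by (simp add: scaleR_add_right scaleR_add_left scaleR_sum_right sum.distrib)
      then show ?thesis using uv(3) t(2) r(2) by (simp add: f_def)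
    qed
    moreover have "0 \<le> u * t i + v * r i \<and> u * t i + v * r i \<le> 1" if "i < s" for i
      using t(1) r(1) that uv convex_bound_le[of "t i" 1 "r i" u v] by auto
    ultimately show "u *\<^sub>R y + v *\<^sub>R z \<in> T" unfolding T_def by blast
  qed
  moreover have "X i \<in> T" if "i \<le> s" for i
  proof -
    have "X i = f (\<lambda>j. if j = i then 1 else 0)"
      using that unfolding f_def by (auto simp: if_distrib[of "\<lambda>c. c *\<^sub>R _"] cong: if_cong)
    moreover have "f (\<lambda>j. if j = i then 1 else 0) \<in> T" unfolding T_def by (rule imageI) auto
    ultimately show ?thesis by simp
  qed
  ultimately have hullT: "convex hull (X ` {..s}) \<subseteq> T" by (intro hull_minimal) auto
  have "hausdorff_pre s \<delta> T \<le> ennreal (unit_ball_vol s * L ^ s)" if \<delta>: "0 < \<delta>" for \<delta>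
  proof -
    obtain N0 :: nat where N0: "L / \<delta> < real N0" using reals_Archimedean2 by blast
    define N where "N = Suc N0"
    have N: "0 < N" "L / real N \<le> \<delta>"
    proof -
      have "L / \<delta> \<le> real N" using N0 by (simp add: N_def)
      then have "L \<le> \<delta> * real N" using \<delta> by (simp add: field_simps)
      then show "0 < N" "L / real N \<le> \<delta>" by (auto simp: N_def field_simps)
    qed
    define cell where "cell c = f ` {t. \<forall>i<s. real (c i) / N \<le> t i \<and> t i \<le> (real (c i) + 1) / N}"
      for c :: "nat \<Rightarrow> nat"
    have cell: "dist y z \<le> L / N" if yz: "y \<in> cell c" "z \<in> cell c" for c y z
    proof -
      obtain t r where t: "\<forall>i<s. real (c i) / N \<le> t i \<and> t i \<le> (real (c i) + 1) / N" "y = f t"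
        and r: "\<forall>i<s. real (c i) / N \<le> r i \<and> r i \<le> (real (c i) + 1) / N" "z = f r"
        using yz by (auto simp: cell_def)
      have "y - z = (\<Sum>i<s. (t i - r i) *\<^sub>R (X i - X s))"
        unfolding t r f_def by (simp add: sum_subtractf scaleR_diff_left)
      then have "norm (y - z) \<le> (\<Sum>i<s. \<bar>t i - r i\<bar> * norm (X i - X s))"
        using norm_sum[of "\<lambda>i. (t i - r i) *\<^sub>R (X i - X s)" "{..<s}"] by simp
      also have "\<dots> \<le> (\<Sum>i<s. 1 / N * norm (X i - X s))"
      proof (intro sum_mono mult_right_mono)
        fix i assume "i \<in> {..<s}"
        then show "\<bar>t i - r i\<bar> \<le> 1 / N"
          using t(1) r(1) by (fastforce simp: add_divide_distrib abs_le_iff)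
      qed simp
      finally show ?thesis by (simp add: L_def dist_norm sum_divide_distrib)
    qed
    have bcell: "bounded (cell c)" "diameter (cell c) \<le> L / N" for c
    proof -
      show "bounded (cell c)" unfolding bounded_two_points using cell by blast
      show "diameter (cell c) \<le> L / N"
        using cell L N by (intro diameter_le) (auto simp: dist_norm)
    qed
    \<comment> \<open>There are \<open>N + 1\<close> indices per direction because the parameter
      value 1 falls into cell \<open>N\<close>. The total weight stays bounded since
      \<open>N + 1 \<le> 2 * N\<close>.\<close>
    let ?I = "{..<s} \<rightarrow>\<^sub>E {..N}"
    have "T \<subseteq> (\<Union>c\<in>?I. cell c)"
    proof
      fix y assume "y \<in> T"
      then obtain t where t: "\<forall>i<s. 0 \<le> t i \<and> t i \<le> 1" "y = f t" by (auto simp: T_def)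
      define c where "c = (\<lambda>i\<in>{..<s}. nat \<lfloor>t i * N\<rfloor>)"
      have c: "real (c i) \<le> t i * N" "t i * N \<le> real (c i) + 1" "c i \<le> N" if "i < s" for i
      proof -
        have tN: "0 \<le> t i * N" "t i * N \<le> N" using t(1) that by (auto simp: mult_left_le_one_le)
        have ci: "c i = nat \<lfloor>t i * N\<rfloor>" using that by (simp add: c_def)
        show "real (c i) \<le> t i * N" "t i * N \<le> real (c i) + 1" unfolding ci using tN(1) by linarith+
        with tN(2) show "c i \<le> N" by linarith
      qed
      have "c \<in> ?I" using c by (auto simp: c_def)
      moreover have "y \<in> cell c"
        unfolding cell_def t(2) using c N by (intro imageI) (auto simp: field_simps)
      ultimately show "y \<in> (\<Union>c\<in>?I. cell c)" by blast
    qed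
    then have "hausdorff_pre s \<delta> T \<le> (\<Sum>c\<in>?I. hausdorff_weight s (cell c))"
      using bcell N \<delta> by (intro hausdorff_pre_finite_cover) (auto intro: finite_PiE order_trans[OF bcell(2)])
    also have "\<dots> \<le> (\<Sum>c\<in>?I. ennreal (unit_ball_vol s * (L / N / 2) ^ s))"
      using bcell diameter_ge_0[OF bcell(1)] L
      by (intro sum_mono) (auto simp: hausdorff_weight_def intro!: ennreal_leI mult_left_mono power_mono)
    also have "\<dots> = ennreal (real (card ?I) * (unit_ball_vol s * (L / N / 2) ^ s))"
      using L by (simp add: ennreal_mult ennreal_of_nat_eq_real_of_nat)
    also have "\<dots> \<le> ennreal (unit_ball_vol s * L ^ s)"
    proof (rule ennreal_leI)
      have "real (card ?I) * (L / N / 2) ^ s = ((real N + 1) / (2 * N) * L) ^ s"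
        by (simp add: card_PiE power_mult_distrib power_divide add.commute)
      also have "\<dots> \<le> (1 * L) ^ s"
        using N L by (intro power_mono mult_right_mono) (auto simp: field_simps)
      finally show "real (card ?I) * (unit_ball_vol s * (L / N / 2) ^ s) \<le> unit_ball_vol s * L ^ s"
        by (simp add: mult.left_commute mult_left_mono)
    qed
    finally show ?thesis .
  qed
  then have "hausdorff_outer s T \<le> ennreal (unit_ball_vol s * L ^ s)"
    unfolding hausdorff_outer_def by (intro SUP_least) auto
  with hausdorff_outer_mono[OF hullT, of s] show ?thesis
    by (meson ennreal_less_top le_less_trans)
qed

text \<open>The coordinates along \<open>e\<close> are 1-Lipschitz, so they map a set of diameter d
  into a cube of side 2d. The cubes of a cover of \<open>C\<close> cover the box, and comparing
  Lebesgue volumes gives the bound; \<open>(2 * d) ^ s = 4 ^ s * (d / 2) ^ s\<close> explains the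
  factor \<open>4 ^ s\<close>.\<close>

lemma hausdorff_outer_ge_box:
  fixes e :: "nat \<Rightarrow> 'a::real_inner" and a b :: "nat \<Rightarrow> real"
  assumes e: "\<And>j. j < s \<Longrightarrow> norm (e j) \<le> 1" and ab: "\<And>j. j < s \<Longrightarrow> a j \<le> b j"
    and C: "\<And>q. (\<And>j. j < s \<Longrightarrow> a j \<le> q j \<and> q j \<le> b j) \<Longrightarrow> \<exists>y\<in>C. \<forall>j<s. y \<bullet> e j = q j"
  shows "ennreal (unit_ball_vol s / 4 ^ s * (\<Prod>j<s. b j - a j)) \<le> hausdorff_outer s C"
proof -
  interpret product_sigma_finite "\<lambda>_ :: nat. lborel :: real measure" by standard
  let ?P = "Pi\<^sub>M {..<s} (\<lambda>_. lborel :: real measure)"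
  have box: "Pi\<^sub>E {..<s} (\<lambda>j. {u j..v j}) \<in> sets ?P" for u v :: "nat \<Rightarrow> real"
    by (intro sets_PiM_I_finite) auto
  have vol: "emeasure ?P (Pi\<^sub>E {..<s} (\<lambda>j. {u j..v j})) = ennreal (\<Prod>j<s. v j - u j)"
    if "\<And>j. j < s \<Longrightarrow> u j \<le> v j" for u v :: "nat \<Rightarrow> real"
    by (subst emeasure_PiM) (use that in \<open>auto intro!: prod_ennreal\<close>)
  have "ennreal (unit_ball_vol s / 4 ^ s * (\<Prod>j<s. b j - a j)) \<le> hausdorff_pre s 1 C"
    unfolding hausdorff_pre_def
  proof (rule INF_greatest, clarify)
    fix U :: "nat \<Rightarrow> 'a set"
    assume cov: "C \<subseteq> (\<Union>k. U k)" and U: "\<forall>k. bounded (U k) \<and> diameter (U k) \<le> 1"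
    define p where "p k = (SOME u. u \<in> U k)" for k
    have p: "p k \<in> U k" if "U k \<noteq> {}" for k
      using that unfolding p_def by (rule some_in_eq[THEN iffD2])
    let ?d = "\<lambda>k. diameter (U k)"
    have d: "0 \<le> ?d k" for k using U by (intro diameter_ge_0) auto
    \<comment> \<open>The case distinction matters for \<open>s = 0\<close>, where a cube of side 0
      has volume 1 but the empty set has weight 0.\<close>
    define B where "B k = (if U k = {} then {} else Pi\<^sub>E {..<s} (\<lambda>j. {p k \<bullet> e j - ?d k .. p k \<bullet> e j + ?d k}))" for k
    have "Pi\<^sub>E {..<s} (\<lambda>j. {a j..b j}) \<subseteq> (\<Union>k. B k)"
    proof
      fix q assume q: "q \<in> Pi\<^sub>E {..<s} (\<lambda>j. {a j..b j})"
      then obtain y where y: "y \<in> C" "\<forall>j<s. y \<bullet> e j = q j"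
        using C[of q] by (auto simp: PiE_iff)
      then obtain k where k: "y \<in> U k" using cov by blast
      have "\<bar>y \<bullet> e j - p k \<bullet> e j\<bar> \<le> ?d k" if "j < s" for j
      proof -
        have "\<bar>y \<bullet> e j - p k \<bullet> e j\<bar> \<le> norm (y - p k) * norm (e j)"
          unfolding inner_diff_left[symmetric] by (rule Cauchy_Schwarz_ineq2)
        also have "\<dots> \<le> norm (y - p k)" using e[OF that] by (simp add: mult_left_le)
        also have "\<dots> \<le> ?d k"
          unfolding dist_norm[symmetric] using U k p by (intro diameter_bounded_bound) auto
        finally show ?thesis .
      qed
      then have "q \<in> B k"
        using k q y(2) by (auto simp: B_def PiE_iff abs_le_iff algebra_simps)
      then show "q \<in> (\<Union>k. B k)" by blast
    qed
    then have "emeasure ?P (Pi\<^sub>E {..<s} (\<lambda>j. {a j..b j})) \<le> emeasure ?P (\<Union>k. B k)"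
      by (intro emeasure_mono) (auto simp: B_def box)
    also have "\<dots> \<le> suminf (\<lambda>k. emeasure ?P (B k))"
      by (intro emeasure_subadditive_countably) (auto simp: B_def box)
    finally have "ennreal (unit_ball_vol s / 4 ^ s) * ennreal (\<Prod>j<s. b j - a j)
        \<le> ennreal (unit_ball_vol s / 4 ^ s) * suminf (\<lambda>k. emeasure ?P (B k))"
      using ab by (subst (asm) vol) (auto intro: mult_left_mono)
    also have "\<dots> = suminf (\<lambda>k. ennreal (unit_ball_vol s / 4 ^ s) * emeasure ?P (B k))"
      by simp
    also have "\<dots> = suminf (\<lambda>k. hausdorff_weight s (U k))"
    proof (rule arg_cong[where f = suminf], rule ext)
      fix k
      show "ennreal (unit_ball_vol s / 4 ^ s) * emeasure ?P (B k) = hausdorff_weight s (U k)"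
      proof (cases "U k = {}")
        case False
        then have "emeasure ?P (B k) = ennreal (\<Prod>j<s. 2 * ?d k)"
          unfolding B_def using d[of k] by (simp add: vol)
        then have "ennreal (unit_ball_vol s / 4 ^ s) * emeasure ?P (B k)
            = ennreal (unit_ball_vol s / 4 ^ s * (2 * ?d k) ^ s)"
          using d[of k] by (simp add: ennreal_mult[symmetric])
        also have "unit_ball_vol s / 4 ^ s * (2 * ?d k) ^ s = unit_ball_vol s * (?d k / 2) ^ s"
        proof -
          have "(4::real) ^ s = 2 ^ s * 2 ^ s" by (simp flip: power_mult_distrib)
          then show ?thesis by (simp add: power_mult_distrib power_divide)
        qed
        finally show ?thesis using False by (simp add: hausdorff_weight_def)
      qed (simp add: B_def hausdorff_weight_def)
    qed
    finally show "ennreal (unit_ball_vol s / 4 ^ s * (\<Prod>j<s. b j - a j)) \<le> suminf (\<lambda>k. hausdorff_weight s (U k))"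
      using ab by (subst ennreal_mult) (auto intro!: prod_nonneg)
  qed
  also have "\<dots> \<le> hausdorff_outer s C" by (rule hausdorff_pre_le_outer) simp
  finally show ?thesis .
qed

section \<open>Orthonormal families and orthogonal residuals\<close>

definition orthonormal_upto :: "nat \<Rightarrow> (nat \<Rightarrow> 'a::real_inner) \<Rightarrow> bool"
  where "orthonormal_upto k e \<longleftrightarrow> (\<forall>i<k. \<forall>j<k. e i \<bullet> e j = (if i = j then 1 else 0))"

lemma orthonormal_upto_inner:
  "orthonormal_upto k e \<Longrightarrow> i < k \<Longrightarrow> j < k \<Longrightarrow> e i \<bullet> e j = (if i = j then 1 else 0)"
  by (simp add: orthonormal_upto_def)

lemma orthonormal_upto_mono: "orthonormal_upto k e \<Longrightarrow> j \<le> k \<Longrightarrow> orthonormal_upto j e"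
  by (auto simp: orthonormal_upto_def)

lemma orthonormal_upto_norm: "orthonormal_upto k e \<Longrightarrow> i < k \<Longrightarrow> norm (e i) = 1"
  by (simp add: norm_eq_1 orthonormal_upto_inner)

lemma inner_sum_orthonormal:
  assumes "orthonormal_upto k e" "i < k"
  shows "(\<Sum>j<k. c j *\<^sub>R e j) \<bullet> e i = c i"
proof -
  have "(\<Sum>j<k. c j *\<^sub>R e j) \<bullet> e i = (\<Sum>j<k. if j = i then c j else 0)"
    unfolding inner_sum_left using assms by (intro sum.cong) (auto simp: orthonormal_upto_inner)
  then show ?thesis using assms by simp
qed

text \<open>If \<open>e\<close> is orthonormal up to \<open>k\<close>, this is the component of
  \<open>z\<close> orthogonal to the span of the first \<open>k\<close> vectors, and its norm is the
  distance from \<open>z\<close> to that span.\<close>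

definition residual :: "(nat \<Rightarrow> 'a::real_inner) \<Rightarrow> nat \<Rightarrow> 'a \<Rightarrow> 'a"
  where "residual e k z = z - (\<Sum>j<k. (z \<bullet> e j) *\<^sub>R e j)"

lemma residual_orthogonal: "orthonormal_upto k e \<Longrightarrow> i < k \<Longrightarrow> residual e k z \<bullet> e i = 0"
  using inner_sum_orthonormal[of k e i "\<lambda>j. z \<bullet> e j"] by (simp add: residual_def inner_diff_left)

lemma residual_inner_next:
  assumes "orthonormal_upto (Suc k) e"
  shows "residual e k z \<bullet> e k = z \<bullet> e k"
  using assms by (simp add: residual_def inner_diff_left inner_sum_left orthonormal_upto_inner)

lemma residual_Suc:
  assumes "orthonormal_upto (Suc k) e"
  shows "residual e (Suc k) z = residual e k z - (residual e k z \<bullet> e k) *\<^sub>R e k"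
  unfolding residual_inner_next[OF assms] by (simp add: residual_def)

lemma norm_residual_Suc_le:
  assumes "orthonormal_upto (Suc k) e"
  shows "norm (residual e (Suc k) z) \<le> norm (residual e k z)"
proof (rule power2_le_imp_le)
  have "e k \<bullet> e k = 1" using assms by (simp add: orthonormal_upto_inner)
  then have "(norm (residual e (Suc k) z))\<^sup>2 = (norm (residual e k z))\<^sup>2 - (residual e k z \<bullet> e k)\<^sup>2"
    unfolding residual_Suc[OF assms] power2_norm_eq_inner
    by (simp add: inner_diff_left inner_diff_right inner_commute power2_eq_square)
  then show "(norm (residual e (Suc k) z))\<^sup>2 \<le> (norm (residual e k z))\<^sup>2" by simp
qed simp

lemma norm_residual_antimono:
  assumes "orthonormal_upto k e" "j \<le> k"
  shows "norm (residual e k z) \<le> norm (residual e j z)"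
  using assms(2,1)
proof (induction k rule: dec_induct)
  case (step k)
  then show ?case
    using norm_residual_Suc_le[of k e z] orthonormal_upto_mono[of "Suc k" e k] by fastforce
qed simp

section \<open>Volume of perturbed simplices\<close>

text \<open>A discrete Gronwall estimate: each partial sum is at most twice the preceding one plus
  \<open>B\<close>. It serves to solve a triangular system whose off-diagonal entries are bounded by
  1.\<close>

lemma sum_le_two_power:
  fixes \<alpha> :: "nat \<Rightarrow> real"
  assumes "\<And>i. i < s \<Longrightarrow> \<alpha> i \<le> B + (\<Sum>j<i. \<alpha> j)"
  shows "(\<Sum>j<s. \<alpha> j) \<le> (2 ^ s - 1) * B"
  using assms
proof (induction s)
  case (Suc s)
  have "(\<Sum>j<s. \<alpha> j) \<le> (2 ^ s - 1) * B" using Suc by simp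
  then show ?case using Suc.prems[of s] by (simp add: algebra_simps)
qed simp

text \<open>If the projected hull missed a point of the box, a vector \<open>u\<close> would separate them: \<open>u\<close> is then
  nearly constant on the vertices, and solving the triangular system forces \<open>u\<close> to vanish.\<close>

lemma perturbed_simplex_contains_box:
  fixes e v v' :: "nat \<Rightarrow> 'a::real_inner" and h q :: "nat \<Rightarrow> real" and s :: nat
  defines "c \<equiv> 1 / (4 * 2 ^ s * (real s + 1))"
  defines "g \<equiv> \<lambda>j. (\<Sum>i\<le>s. v i \<bullet> e j) / (real s + 1)"
  assumes orth: "orthonormal_upto s e" and h: "\<And>j. j < s \<Longrightarrow> 0 < h j"
    and le: "\<And>i j. i < s \<Longrightarrow> j < i \<Longrightarrow> \<bar>(v (Suc i) - v 0) \<bullet> e j\<bar> \<le> h j"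
    and diag: "\<And>i. i < s \<Longrightarrow> (v (Suc i) - v 0) \<bullet> e i = h i"
    and upper: "\<And>i j. i < j \<Longrightarrow> j < s \<Longrightarrow> (v (Suc i) - v 0) \<bullet> e j = 0"
    and pert: "\<And>i j. i \<le> s \<Longrightarrow> j < s \<Longrightarrow> norm (v' i - v i) \<le> c * h j"
    and q: "\<And>j. j < s \<Longrightarrow> \<bar>q j - g j\<bar> \<le> c * h j"
  shows "\<exists>y\<in>convex hull (v' ` {..s}). \<forall>j<s. y \<bullet> e j = q j"
proof -
  define P where "P y = (\<Sum>j<s. (y \<bullet> e j) *\<^sub>R e j)" for y
  define p where "p = (\<Sum>j<s. q j *\<^sub>R e j)"
  have linP: "linear P"
    by (rule linearI) (simp_all add: P_def inner_add_left scaleR_add_left sum.distrib scaleR_sum_right)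
  have Pe: "P y \<bullet> e j = y \<bullet> e j" if "j < s" for y j
    unfolding P_def by (rule inner_sum_orthonormal[OF orth that])
  have pe: "p \<bullet> e j = q j" if "j < s" for j
    unfolding p_def by (rule inner_sum_orthonormal[OF orth that])
  define K where "K = convex hull ((\<lambda>i. P (v' i)) ` {..s})"
  have K: "K = P ` (convex hull (v' ` {..s}))"
    unfolding K_def by (simp add: convex_hull_linear_image[OF linP] image_image)
  have "p \<in> K"
  proof (rule ccontr)
    assume pK: "p \<notin> K"
    have cK: "compact K" "convex K" "K \<noteq> {}"
      unfolding K_def by (auto intro!: finite_imp_compact_convex_hull)
    have "continuous_on K (dist p)" by (intro continuous_intros)
    with cK obtain k where k: "k \<in> K" "\<forall>z\<in>K. dist p k \<le> dist p z"
      using continuous_attains_inf[of K "dist p"] by blast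
    define u where "u = p - k"
    have u_le: "u \<bullet> y \<le> u \<bullet> p" if "y \<in> K" for y
    proof -
      have "u \<bullet> (y - k) \<le> 0"
        unfolding u_def by (rule any_closest_point_dot) (use cK k that compact_imp_closed in auto)
      moreover have "0 \<le> u \<bullet> (p - k)" unfolding u_def by simp
      ultimately show ?thesis by (simp add: inner_diff_right)
    qed
    define U where "U j = u \<bullet> e j" for j
    obtain y where y: "k = P y" using k(1) K by auto
    \<comment> \<open>Both \<open>p\<close> and \<open>k\<close> lie in the span of
      \<open>e\<close>, so \<open>u\<close> is determined by the numbers \<open>U j\<close>, and it
      suffices to show that these vanish.\<close>
    have u_eq: "u = (\<Sum>j<s. U j *\<^sub>R e j)"
    proof -
      have "u = (\<Sum>j<s. (q j - y \<bullet> e j) *\<^sub>R e j)"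
        by (simp add: u_def p_def y P_def scaleR_diff_left sum_subtractf)
      moreover have "U j = q j - y \<bullet> e j" if "j < s" for j
        unfolding U_def u_def y using that by (simp add: inner_diff_left Pe pe)
      ultimately show ?thesis by simp
    qed
    have u_inner: "u \<bullet> w = (\<Sum>j<s. U j * (w \<bullet> e j))" for w
      by (subst u_eq) (simp add: inner_sum_left inner_commute[of w])
    \<comment> \<open>This is the rescaling of the axes: measured in units \<open>h j\<close>, the
      coefficients of the triangular system are bounded by 1.\<close>
    define \<alpha> where "\<alpha> j = \<bar>U j\<bar> * h j" for j
    define A where "A = (\<Sum>j<s. \<alpha> j)"
    have \<alpha>0: "0 \<le> \<alpha> j" if "j < s" for j using h[OF that] by (simp add: \<alpha>_def)
    have A0: "0 \<le> A" unfolding A_def using \<alpha>0 by (intro sum_nonneg) auto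
    \<comment> \<open>The value of \<open>u\<close> at vertex i relative to the centroid, at which
      the box is centred. Hence the values sum to 0, and an upper bound on all of them is also a
      lower bound up to the factor \<open>s\<close>.\<close>
    define f where "f i = (\<Sum>j<s. U j * (v i \<bullet> e j - g j))" for i
    have "(\<Sum>i\<le>s. f i) = (\<Sum>j<s. U j * (\<Sum>i\<le>s. v i \<bullet> e j - g j))"
      unfolding f_def by (subst sum.swap) (simp add: sum_distrib_left)
    also have "\<dots> = 0"
      by (intro sum.neutral) (simp add: sum_subtractf g_def add.commute)
    finally have sum0: "(\<Sum>i\<le>s. f i) = 0" .
    \<comment> \<open>By separation \<open>u\<close> is no larger at \<open>v' i\<close> than at
      \<open>p\<close>. Replacing \<open>v' i\<close> by \<open>v i\<close> and \<open>q\<close> by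
      \<open>g\<close> costs at most \<open>c * A\<close> each.\<close>
    have f_le: "f i \<le> 2 * c * A" if i: "i \<le> s" for i
    proof -
      have "P (v' i) \<in> K" unfolding K_def using i by (intro hull_inc) auto
      from u_le[OF this] have *: "(\<Sum>j<s. U j * (v' i \<bullet> e j)) \<le> (\<Sum>j<s. U j * q j)"
        unfolding u_inner by (simp add: Pe pe)
      have "f i = (\<Sum>j<s. U j * ((v i - v' i) \<bullet> e j)) + ((\<Sum>j<s. U j * (v' i \<bullet> e j)) - (\<Sum>j<s. U j * q j))
          + (\<Sum>j<s. U j * (q j - g j))"
        unfolding f_def sum_subtractf[symmetric] sum.distrib[symmetric]
        by (intro sum.cong) (auto simp: inner_diff_left algebra_simps)
      also have "\<dots> \<le> (\<Sum>j<s. c * \<alpha> j) + 0 + (\<Sum>j<s. c * \<alpha> j)"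
      proof (intro add_mono sum_mono)
        fix j assume "j \<in> {..<s}"
        then have j: "j < s" by simp
        have "\<bar>(v i - v' i) \<bullet> e j\<bar> \<le> norm (v i - v' i) * norm (e j)" by (rule Cauchy_Schwarz_ineq2)
        also have "\<dots> \<le> c * h j"
          using pert[OF i j] by (simp add: orthonormal_upto_norm[OF orth j] norm_minus_commute)
        finally have 1: "\<bar>(v i - v' i) \<bullet> e j\<bar> \<le> c * h j" .
        have 2: "U j * x \<le> c * \<alpha> j" if "\<bar>x\<bar> \<le> c * h j" for x
        proof -
          have "U j * x \<le> \<bar>U j\<bar> * \<bar>x\<bar>" by (simp flip: abs_mult)
          also have "\<dots> \<le> \<bar>U j\<bar> * (c * h j)" using that by (intro mult_left_mono) auto
          finally show ?thesis by (simp add: \<alpha>_def mult.left_commute)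
        qed
        show "U j * ((v i - v' i) \<bullet> e j) \<le> c * \<alpha> j" by (rule 2[OF 1])
        show "U j * (q j - g j) \<le> c * \<alpha> j" by (rule 2[OF q[OF j]])
      qed (use * in simp)
      finally show ?thesis by (simp add: A_def sum_distrib_left mult.assoc)
    qed
    define \<epsilon> where "\<epsilon> = 2 * c * A"
    have f_ge: "- (real s * \<epsilon>) \<le> f i" if i: "i \<le> s" for i
    proof -
      have "f i = - (\<Sum>j\<in>{..s} - {i}. f j)"
        using sum0 i by (simp add: sum.remove[of "{..s}" i])
      moreover have "(\<Sum>j\<in>{..s} - {i}. f j) \<le> (\<Sum>j\<in>{..s} - {i}. \<epsilon>)"
        using f_le by (intro sum_mono) (auto simp: \<epsilon>_def)
      ultimately show ?thesis using i by simp
    qed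
    \<comment> \<open>Along the edge from vertex 0 to vertex \<open>Suc i\<close> only the
      coordinates up to i occur, so the nearly constant \<open>f\<close> controls the diagonal term
      \<open>U i * h i\<close> by the earlier ones.\<close>
    have "\<alpha> i \<le> (real s + 1) * \<epsilon> + (\<Sum>j<i. \<alpha> j)" if i: "i < s" for i
    proof -
      let ?t = "\<lambda>j. U j * ((v (Suc i) - v 0) \<bullet> e j)"
      have "f (Suc i) - f 0 = (\<Sum>j<s. ?t j)"
        unfolding f_def sum_subtractf[symmetric]
        by (intro sum.cong) (auto simp: inner_diff_left algebra_simps)
      also have "\<dots> = (\<Sum>j<Suc i. ?t j)"
        using i upper[of i] by (intro sum.mono_neutral_right) (auto simp: not_less Suc_le_eq)
      also have "\<dots> = (\<Sum>j<i. ?t j) + U i * h i" using diag[OF i] by simp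
      finally have "\<bar>U i * h i\<bar> \<le> \<bar>f (Suc i) - f 0\<bar> + \<bar>\<Sum>j<i. ?t j\<bar>" by linarith
      moreover have "\<bar>f (Suc i) - f 0\<bar> \<le> (real s + 1) * \<epsilon>"
        using f_le[of "Suc i", folded \<epsilon>_def] f_le[of 0, folded \<epsilon>_def]
          f_ge[of "Suc i"] f_ge[of 0] i
        by (simp add: abs_le_iff distrib_right)
      moreover have "\<bar>\<Sum>j<i. ?t j\<bar> \<le> (\<Sum>j<i. \<alpha> j)"
        using le[OF i] by (intro order_trans[OF sum_abs] sum_mono) (auto simp: \<alpha>_def abs_mult intro!: mult_left_mono)
      moreover have "\<bar>U i * h i\<bar> = \<alpha> i" using h[OF i] by (simp add: \<alpha>_def abs_mult)
      ultimately show ?thesis by linarith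
    qed
    then have "A \<le> (2 ^ s - 1) * ((real s + 1) * \<epsilon>)"
      unfolding A_def by (rule sum_le_two_power)
    also have "\<dots> \<le> 2 ^ s * ((real s + 1) * \<epsilon>)"
      using A0 by (intro mult_right_mono) (auto simp: \<epsilon>_def c_def)
    \<comment> \<open>The choice of \<open>c\<close> turns this into \<open>A / 2\<close>:
      \<open>2 ^ s\<close> absorbs the triangular system, \<open>real s + 1\<close> the oscillation
      of \<open>f\<close>, and 4 leaves the factor 1/2 that forces \<open>A = 0\<close>.\<close>
    also have "\<dots> = 2 * A * (2 ^ s * (real s + 1) * c)" by (simp add: \<epsilon>_def)
    also have "2 ^ s * (real s + 1) * c = 1 / 4"
      using of_nat_0_le_iff[of s, where ?'a = real] by (simp add: c_def divide_simps)
    finally have "A = 0" using A0 by simp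
    then have "\<forall>j\<in>{..<s}. \<alpha> j = 0" unfolding A_def using \<alpha>0 by (subst (asm) sum_nonneg_eq_0_iff) auto
    then have "U j = 0" if "j < s" for j
      using that h[OF that] by (auto simp: \<alpha>_def)
    then have "u = 0" by (subst u_eq) simp
    then show False using pK k(1) by (simp add: u_def)
  qed
  then obtain y where "y \<in> convex hull (v' ` {..s})" "p = P y" unfolding K by blast
  then show ?thesis using Pe pe by metis
qed

text \<open>The single tolerance \<open>c * h0\<close> respects every anisotropic tolerance
  \<open>c * h j\<close>, so the perturbed simplex still projects onto a box with sides
  \<open>2 * c * h j\<close>, each at least \<open>2 * c * h0\<close>.\<close>

lemma measure_perturbed_simplex_ge:
  fixes e v v' :: "nat \<Rightarrow> 'a::real_inner" and h :: "nat \<Rightarrow> real" and s :: nat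
  defines "c \<equiv> 1 / (4 * 2 ^ s * (real s + 1))"
  assumes orth: "orthonormal_upto s e" and h0: "0 < h0" "\<And>j. j < s \<Longrightarrow> h0 \<le> h j"
    and le: "\<And>i j. i < s \<Longrightarrow> j < i \<Longrightarrow> \<bar>(v (Suc i) - v 0) \<bullet> e j\<bar> \<le> h j"
    and diag: "\<And>i. i < s \<Longrightarrow> (v (Suc i) - v 0) \<bullet> e i = h i"
    and upper: "\<And>i j. i < j \<Longrightarrow> j < s \<Longrightarrow> (v (Suc i) - v 0) \<bullet> e j = 0"
    and pert: "\<And>i. i \<le> s \<Longrightarrow> norm (v' i - v i) \<le> c * h0"
  shows "unit_ball_vol s / 4 ^ s * (2 * c * h0) ^ s
    \<le> measure (hausdorff_measure s) (convex hull (v' ` {..s}))"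
proof -
  let ?C = "convex hull (v' ` {..s})"
  define g where "g j = (\<Sum>i\<le>s. v i \<bullet> e j) / (real s + 1)" for j
  have c: "0 < c" by (simp add: c_def)
  have h: "0 < h j" if "j < s" for j using h0(1) h0(2)[OF that] by linarith
  have "ennreal (unit_ball_vol s / 4 ^ s * (\<Prod>j<s. (g j + c * h j) - (g j - c * h j))) \<le> hausdorff_outer s ?C"
  proof (rule hausdorff_outer_ge_box)
    fix q assume q: "\<And>j. j < s \<Longrightarrow> g j - c * h j \<le> q j \<and> q j \<le> g j + c * h j"
    show "\<exists>y\<in>?C. \<forall>j<s. y \<bullet> e j = q j"
    proof (rule perturbed_simplex_contains_box[OF orth h le diag upper])
      fix i j assume ij: "i \<le> s" "j < s"
      have "c * h0 \<le> c * h j" using c h0(2)[OF ij(2)] by simp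
      with pert[OF ij(1)] show "norm (v' i - v i) \<le> 1 / (4 * 2 ^ s * (real s + 1)) * h j"
        by (simp add: c_def)
    next
      fix j assume "j < s"
      from q[OF this] show "\<bar>q j - (\<Sum>i\<le>s. v i \<bullet> e j) / (real s + 1)\<bar> \<le> 1 / (4 * 2 ^ s * (real s + 1)) * h j"
        by (auto simp: g_def c_def abs_le_iff)
    qed auto
  next
    fix j assume "j < s"
    then show "g j - c * h j \<le> g j + c * h j" using c h by (simp add: less_imp_le)
  qed (use orthonormal_upto_norm[OF orth] in auto)
  moreover have "(2 * c * h0) ^ s \<le> (\<Prod>j<s. (g j + c * h j) - (g j - c * h j))"
  proof -
    have "(\<Prod>j<s. 2 * c * h0) \<le> (\<Prod>j<s. (g j + c * h j) - (g j - c * h j))"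
      using c h0 by (intro prod_mono) (auto simp: less_imp_le)
    then show ?thesis by simp
  qed
  ultimately have "ennreal (unit_ball_vol s / 4 ^ s * (2 * c * h0) ^ s) \<le> hausdorff_outer s ?C"
    by (elim order_trans[rotated], intro ennreal_leI mult_left_mono) auto
  moreover have "closed ?C" by (intro compact_imp_closed finite_imp_compact_convex_hull) simp
  then have "emeasure (hausdorff_measure s) ?C = hausdorff_outer s ?C"
    by (intro emeasure_hausdorff_measure) simp
  moreover from this have "emeasure (hausdorff_measure s) ?C = ennreal (measure (hausdorff_measure s) ?C)"
    using hausdorff_outer_convex_hull_finite[of s v'] by (intro emeasure_eq_ennreal_measure) simp
  ultimately have "ennreal (unit_ball_vol s / 4 ^ s * (2 * c * h0) ^ s)
      \<le> ennreal (measure (hausdorff_measure s) ?C)"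
    by metis
  then show ?thesis by (subst (asm) ennreal_le_iff) auto
qed

section \<open>The greedy choice of vertices and directions\<close>

lemma subspace_real_space: "subspace (real_space n)"
  by (auto simp: subspace_def real_space_def lookup_add)

lemma residual_in_subspace:
  assumes "subspace V" "z \<in> V" "\<And>i. i < k \<Longrightarrow> e i \<in> V"
  shows "residual e k z \<in> V"
  unfolding residual_def using assms by (intro subspace_diff subspace_sum subspace_scale) auto

lemma residual_cong: "(\<And>i. i < k \<Longrightarrow> e i = e' i) \<Longrightarrow> residual e k z = residual e' k z"
  by (simp add: residual_def)

lemma orthonormal_independent:
  assumes "orthonormal_upto k e"
  shows "independent (e ` {..<k})" "card (e ` {..<k}) = k"
proof -
  show "independent (e ` {..<k})"
    using assms by (intro pairwise_orthogonal_independent)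
      (auto simp: pairwise_def orthogonal_def orthonormal_upto_inner dest: orthonormal_upto_norm)
  have "inj_on e {..<k}"
  proof (rule inj_onI)
    fix i j assume ij: "i \<in> {..<k}" "j \<in> {..<k}" and eq: "e i = e j"
    have "e i \<bullet> e j = 1" using eq assms ij by (simp add: orthonormal_upto_inner)
    then show "i = j" using assms ij by (simp add: orthonormal_upto_inner split: if_splits)
  qed
  then show "card (e ` {..<k}) = k" by (simp add: card_image)
qed

lemma orthonormal_singles: "orthonormal_upto n (\<lambda>i. Poly_Mapping.single i (1::real))"
  by (auto simp: orthonormal_upto_def inner_poly_mapping_def lookup_single when_def)

text \<open>Supplies a direction when the residuals vanish. The ambient type is
  infinite-dimensional, but the direction has to stay in \<open>real_space n\<close> for the
  resulting plane to belong to the Grassmannian; by dimension, some standard basis vector lies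
  outside the span, and its residual is normalised.\<close>

lemma exists_unit_orthogonal:
  fixes e :: "nat \<Rightarrow> point"
  assumes orth: "orthonormal_upto k e" and k: "k < n"
    and e: "\<And>i. i < k \<Longrightarrow> e i \<in> real_space n"
  obtains u where "norm u = 1" "u \<in> real_space n" "\<And>i. i < k \<Longrightarrow> u \<bullet> e i = 0"
proof -
  let ?b = "\<lambda>i. Poly_Mapping.single i (1::real)"
  have "\<not> ?b ` {..<n} \<subseteq> span (e ` {..<k})"
  proof
    assume "?b ` {..<n} \<subseteq> span (e ` {..<k})"
    then have "card (?b ` {..<n}) \<le> card (e ` {..<k})"
      by (intro conjunct2[OF independent_span_bound] orthonormal_independent(1)[OF orthonormal_singles]) auto
    then show False
      using k orthonormal_independent(2)[OF orth] orthonormal_independent(2)[OF orthonormal_singles[of n]]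
      by simp
  qed
  then obtain i where i: "i < n" "?b i \<notin> span (e ` {..<k})" by auto
  define r where "r = residual e k (?b i)"
  have "r \<noteq> 0"
  proof
    assume "r = 0"
    then have "?b i = (\<Sum>j<k. (?b i \<bullet> e j) *\<^sub>R e j)" by (simp add: r_def residual_def)
    also have "\<dots> \<in> span (e ` {..<k})" by (intro span_sum span_scale span_base) auto
    finally show False using i by blast
  qed
  moreover have "r \<in> real_space n"
    unfolding r_def using i e
    by (intro residual_in_subspace subspace_real_space) (auto simp: real_space_def lookup_single)
  ultimately show thesis
    by (intro that[of "r /\<^sub>R norm r"])
      (auto intro: subspace_scale[OF subspace_real_space] simp: r_def residual_orthogonal[OF orth])
qed

text \<open>Each \<open>v i\<close> is a point of \<open>S\<close> farthest from the affine plane through \<open>x\<close> and the earlier points,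
  and \<open>e i\<close> is the direction of its residual.  When the residual vanishes \<open>e i\<close> is arbitrary.\<close>

definition greedy_frame :: "point set \<Rightarrow> point \<Rightarrow> nat \<Rightarrow> nat \<Rightarrow> (nat \<Rightarrow> point) \<Rightarrow> (nat \<Rightarrow> point) \<Rightarrow> bool"
  where "greedy_frame S x n k e v \<longleftrightarrow> orthonormal_upto k e \<and>
    (\<forall>i<k. e i \<in> real_space n \<and> v i \<in> S \<and>
      residual e i (v i - x) = ((v i - x) \<bullet> e i) *\<^sub>R e i \<and>
      (\<forall>z\<in>S. norm (residual e i (z - x)) \<le> (v i - x) \<bullet> e i))"

text \<open>Compactness yields a farthest point. Its normalised residual is the new direction if it
  is nonzero; otherwise a free direction is taken, for which \<open>k < n\<close> is required. The
  second alternative in \<open>next_dir\<close> serves the step from \<open>m\<close> to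
  \<open>m + 1\<close>, where \<open>m < n\<close> is not assumed.\<close>

lemma greedy_frame_Suc:
  assumes fr: "greedy_frame S x n k e v" and S: "compact S" "x \<in> S" "S \<subseteq> real_space n"
    and next_dir: "k < n \<or> (\<exists>z\<in>S. residual e k (z - x) \<noteq> 0)"
  shows "\<exists>e' v'. greedy_frame S x n (Suc k) e' v' \<and> (\<forall>i<k. e' i = e i)"
proof -
  have orth: "orthonormal_upto k e" and e: "\<And>i. i < k \<Longrightarrow> e i \<in> real_space n"
    using fr by (auto simp: greedy_frame_def)
  have "continuous_on S (\<lambda>z. norm (residual e k (z - x)))"
    unfolding residual_def by (intro continuous_intros)
  then obtain w where w: "w \<in> S" "\<And>z. z \<in> S \<Longrightarrow> norm (residual e k (z - x)) \<le> norm (residual e k (w - x))"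
    using continuous_attains_sup[OF S(1)] S(2) by blast
  define r where "r = residual e k (w - x)"
  have "\<exists>u. norm u = 1 \<and> u \<in> real_space n \<and> (\<forall>i<k. u \<bullet> e i = 0) \<and> r = norm r *\<^sub>R u"
  proof (cases "r = 0")
    case True
    then have "k < n" using next_dir w(2) by (fastforce simp: r_def)
    from exists_unit_orthogonal[OF orth this e] True show ?thesis by (metis norm_zero scaleR_zero_left)
  next
    case False
    have "r \<in> real_space n"
      unfolding r_def using S w(1) e
      by (intro residual_in_subspace subspace_diff subspace_real_space) auto
    with False show ?thesis
      by (intro exI[of _ "r /\<^sub>R norm r"])
        (auto intro: subspace_scale[OF subspace_real_space] simp: r_def residual_orthogonal[OF orth])
  qed
  then obtain u where u: "norm u = 1" "u \<in> real_space n" "\<And>i. i < k \<Longrightarrow> u \<bullet> e i = 0" "r = norm r *\<^sub>R u"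
    by blast
  define e' where "e' = e(k := u)"
  define v' where "v' = v(k := w)"
  have res: "residual e' i z = residual e i z" if "i \<le> k" for i z
    using that by (intro residual_cong) (auto simp: e'_def)
  have uu: "u \<bullet> u = 1" using u(1) by (simp add: norm_eq_1)
  have orth': "orthonormal_upto (Suc k) e'"
    using orth u(3) uu unfolding orthonormal_upto_def e'_def
    by (auto simp: less_Suc_eq inner_commute)
  have "(w - x) \<bullet> u = norm r"
  proof -
    have "(w - x) \<bullet> u = r \<bullet> u"
      using residual_inner_next[OF orth', of "w - x"] res[of k "w - x"] by (simp add: r_def e'_def)
    also have "\<dots> = norm r" by (subst u(4)) (simp add: uu)
    finally show ?thesis .
  qed
  moreover have "greedy_frame S x n (Suc k) e' v'"
    unfolding greedy_frame_def
  proof (intro conjI allI impI orth')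
    fix i assume "i < Suc k"
    then consider "i < k" | "i = k" by linarith
    then show "e' i \<in> real_space n" "v' i \<in> S"
      "residual e' i (v' i - x) = ((v' i - x) \<bullet> e' i) *\<^sub>R e' i"
      "\<forall>z\<in>S. norm (residual e' i (z - x)) \<le> (v' i - x) \<bullet> e' i"
      using fr u w \<open>(w - x) \<bullet> u = norm r\<close>
      by (cases; force simp: greedy_frame_def res e'_def[THEN fun_cong] v'_def r_def[symmetric])+
  qed
  ultimately show ?thesis by (intro exI[of _ e'] exI[of _ v']) (auto simp: e'_def)
qed

lemma greedy_frame_exists:
  assumes "compact S" "x \<in> S" "S \<subseteq> real_space n" "k \<le> n"
  shows "\<exists>e v. greedy_frame S x n k e v"
  using assms(4)
proof (induction k)
  case 0
  show ?case by (simp add: greedy_frame_def orthonormal_upto_def)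
next
  case (Suc k)
  then obtain e v where "greedy_frame S x n k e v" by auto
  from greedy_frame_Suc[OF this assms(1-3)] Suc.prems show ?case by auto
qed

text \<open>The shape of the matrix of edge coordinates. The coordinate along \<open>e j\<close>
  only sees the residual at level j, whose norm is maximal at \<open>v j\<close>; each
  \<open>v i\<close> lies in the plane through \<open>x\<close> spanned by \<open>e\<close> up to i;
  and the diagonal decreases because residuals shrink as the span grows.\<close>

lemma greedy_frame_coordinates:
  assumes fr: "greedy_frame S x n k e v"
  shows "z \<in> S \<Longrightarrow> j < k \<Longrightarrow> \<bar>(z - x) \<bullet> e j\<bar> \<le> (v j - x) \<bullet> e j"
    and "i < j \<Longrightarrow> j < k \<Longrightarrow> (v i - x) \<bullet> e j = 0"
    and "i \<le> j \<Longrightarrow> j < k \<Longrightarrow> (v j - x) \<bullet> e j \<le> (v i - x) \<bullet> e i"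
proof -
  have orth: "orthonormal_upto k e" using fr by (simp add: greedy_frame_def)
  have res: "\<bar>(z - x) \<bullet> e j\<bar> \<le> norm (residual e j (z - x))" if "j < k" for z j
  proof -
    have "(z - x) \<bullet> e j = residual e j (z - x) \<bullet> e j"
      using orthonormal_upto_mono[OF orth, of "Suc j"] that by (subst residual_inner_next) auto
    then show ?thesis
      using Cauchy_Schwarz_ineq2[of "residual e j (z - x)" "e j"] orthonormal_upto_norm[OF orth that]
      by simp
  qed
  have max: "norm (residual e j (z - x)) \<le> (v j - x) \<bullet> e j" if "z \<in> S" "j < k" for z j
    using fr that by (auto simp: greedy_frame_def)
  show "\<bar>(z - x) \<bullet> e j\<bar> \<le> (v j - x) \<bullet> e j" if "z \<in> S" "j < k"
    using res max that order_trans by blast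
  show "(v i - x) \<bullet> e j = 0" if "i < j" "j < k"
  proof -
    have "residual e i (v i - x) = ((v i - x) \<bullet> e i) *\<^sub>R e i"
      using fr that by (auto simp: greedy_frame_def)
    then have "v i - x = (\<Sum>l<i. ((v i - x) \<bullet> e l) *\<^sub>R e l) + ((v i - x) \<bullet> e i) *\<^sub>R e i"
      by (simp add: residual_def algebra_simps)
    then have "(v i - x) \<bullet> e j = ((\<Sum>l<i. ((v i - x) \<bullet> e l) *\<^sub>R e l) + ((v i - x) \<bullet> e i) *\<^sub>R e i) \<bullet> e j"
      by simp
    also have "\<dots> = 0"
      using orth that by (simp add: inner_add_left inner_sum_left orthonormal_upto_inner)
    finally show ?thesis .
  qed
  show "(v j - x) \<bullet> e j \<le> (v i - x) \<bullet> e i" if "i \<le> j" "j < k"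
  proof -
    have vj: "v j \<in> S" using fr that by (auto simp: greedy_frame_def)
    have "(v j - x) \<bullet> e j \<le> norm (residual e j (v j - x))" using res[OF that(2), of "v j"] by linarith
    also have "\<dots> \<le> norm (residual e i (v j - x))"
      using orthonormal_upto_mono[OF orth, of j] that by (intro norm_residual_antimono) auto
    also have "\<dots> \<le> (v i - x) \<bullet> e i" using that by (intro max vj) auto
    finally show ?thesis .
  qed
qed

section \<open>Beta numbers and the lower bound for the energy\<close>

lemma beta_number_le:
  assumes orth: "orthonormal_upto m e" and e: "\<And>i. i < m \<Longrightarrow> e i \<in> real_space n"
    and x: "x \<in> \<Sigma>" and r: "0 < r"
    and h: "\<And>z. z \<in> \<Sigma> \<inter> cball x r \<Longrightarrow> norm (residual e m (z - x)) \<le> h"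
  shows "beta_number n m \<Sigma> x r \<le> h / r"
proof -
  let ?H = "span (e ` {..<m})"
  let ?f = "\<lambda>H. SUP z\<in>\<Sigma> \<inter> cball x r. infdist z ((+) x ` H)"
  have "?H \<subseteq> real_space n"
    using e by (intro span_minimal subspace_real_space) auto
  then have H: "?H \<in> grassmannian n m"
    using orthonormal_independent[OF orth] by (simp add: grassmannian_def dim_eq_card_independent)
  have ne: "\<Sigma> \<inter> cball x r \<noteq> {}" using x r by auto
  \<comment> \<open>Real infima and suprema need explicit bounds. Every plane passes through
    \<open>x\<close>, so its distances to points of the ball lie between 0 and
    \<open>r\<close>.\<close>
  have bdd: "bdd_below (?f ` grassmannian n m)"
  proof (rule bdd_belowI2)
    fix H assume "H \<in> grassmannian n m"
    then have "0 \<in> H" by (simp add: grassmannian_def subspace_0)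
    then have "x \<in> (+) x ` H" by force
    then have "infdist z ((+) x ` H) \<le> r" if "z \<in> \<Sigma> \<inter> cball x r" for z
      using infdist_le[of x "(+) x ` H" z] that by (auto simp: dist_commute)
    then have "bdd_above ((\<lambda>z. infdist z ((+) x ` H)) ` (\<Sigma> \<inter> cball x r))"
      by (intro bdd_aboveI2)
    then have "infdist x ((+) x ` H) \<le> ?f H" using x r by (intro cSUP_upper) auto
    then show "0 \<le> ?f H" using infdist_nonneg[of x "(+) x ` H"] by linarith
  qed
  have "(INF H\<in>grassmannian n m. ?f H) \<le> ?f ?H" by (rule cINF_lower[OF bdd H])
  also have "\<dots> \<le> h"
  proof (rule cSUP_least[OF ne])
    fix z assume z: "z \<in> \<Sigma> \<inter> cball x r"
    let ?p = "\<Sum>j<m. ((z - x) \<bullet> e j) *\<^sub>R e j"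
    have "?p \<in> ?H" by (intro span_sum span_scale span_base) auto
    then have "infdist z ((+) x ` ?H) \<le> dist z (x + ?p)" by (intro infdist_le) auto
    also have "\<dots> = norm (residual e m (z - x))" by (simp add: dist_norm residual_def algebra_simps)
    also have "\<dots> \<le> h" by (rule h[OF z])
    finally show "infdist z ((+) x ` ?H) \<le> h" .
  qed
  finally show ?thesis using r by (simp add: beta_number_def divide_right_mono)
qed

text \<open>Two distinct vertices keep the diameter positive, so that the quotient is a genuine one
  and replacing the diameter by the larger \<open>D\<close> decreases it.\<close>

lemma menger_curvature_ge:
  assumes V: "0 < V" "V \<le> measure (hausdorff_measure (m + 1)) (convex hull (w ` {..m + 1}))"
    and D: "diameter (w ` {..m + 1}) \<le> D" and ne: "w 0 \<noteq> w 1"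
  shows "V / D ^ (m + 2) \<le> menger_curvature m w"
proof -
  have "dist (w 0) (w 1) \<le> diameter (w ` {..m + 1})"
    by (intro diameter_bounded_bound finite_imp_bounded) auto
  with ne have "0 < diameter (w ` {..m + 1})" using zero_less_dist_iff[of "w 0" "w 1"] by linarith
  then show ?thesis
    unfolding menger_curvature_def using V D by (intro frac_le power_mono) auto
qed

text \<open>\<open>K\<close> collects the volume constant and \<open>4 ^ (m + 2)\<close> from the
  diameter bound \<open>4 * r\<close>; \<open>B\<close> is the constant of the product inequality
  for factors near the vertices at radius \<open>c * h\<close>, with half of the Ahlfors bound on
  each.\<close>

lemma menger_energy_ge:
  fixes m l n :: nat and p :: real
  defines "c \<equiv> 1 / (4 * 2 ^ (m + 1) * (real (m + 1) + 1))"
  defines "K \<equiv> unit_ball_vol (m + 1) / 4 ^ (m + 1) * (2 * c) ^ (m + 1) / 4 ^ (m + 2)"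
  defines "B \<equiv> unit_ball_vol (m * l) / 4 ^ (m * l) * (c ^ m / (2 * (unit_ball_vol m * (3 / 2) ^ m))) ^ l"
  assumes m: "1 \<le> m" and l: "1 \<le> l" "l \<le> m + 2" and p: "0 \<le> p"
    and \<Sigma>: "compact \<Sigma>" and A: "0 < A"
    and ahl: "\<And>x r. x \<in> \<Sigma> \<Longrightarrow> 0 < r \<Longrightarrow> r \<le> R \<Longrightarrow> ennreal (A * r ^ m) \<le> emeasure (hausdorff_measure m) (\<Sigma> \<inter> ball x r)"
    and x: "x \<in> \<Sigma>" and r: "0 < r" "r \<le> R"
    and fr: "greedy_frame (\<Sigma> \<inter> cball x r) x n (Suc m) e v"
  defines "h \<equiv> (v m - x) \<bullet> e m"
  assumes h: "0 < h"
  shows "h \<le> r"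
    and "ennreal ((K * (h ^ (m + 1) / r ^ (m + 2))) powr p * (B * (A * h ^ m) ^ l)) \<le> menger_energy m l p \<Sigma>"
proof -
  let ?S = "\<Sigma> \<inter> cball x r"
  have orth: "orthonormal_upto (m + 1) e" using fr by (simp add: greedy_frame_def)
  have v: "v i \<in> ?S" if "i \<le> m" for i using fr that by (auto simp: greedy_frame_def)
  have H: "h \<le> (v i - x) \<bullet> e i" if "i \<le> m" for i
    unfolding h_def using greedy_frame_coordinates(3)[OF fr that] by simp
  have norm_v: "h \<le> norm (v i - x)" if "i \<le> m" for i
    using H[OF that] Cauchy_Schwarz_ineq2[of "v i - x" "e i"] orthonormal_upto_norm[OF orth, of i] that
    by simp
  show hr: "h \<le> r" using norm_v[of m] v[of m] by (auto simp: dist_norm norm_minus_commute)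
  have "(1::real) * 1 \<le> 2 ^ (m + 1) * (real (m + 1) + 1)" by (intro mult_mono one_le_power) auto
  then have c: "0 < c" "c \<le> 1 / 4"
    unfolding c_def by (auto intro!: divide_left_mono[of 4 _ 1, simplified] simp: add_pos_nonneg)
  define \<rho> where "\<rho> = c * h"
  have \<rho>: "0 < \<rho>" "\<rho> \<le> h / 4" using c h by (auto simp: \<rho>_def field_simps)
  \<comment> \<open>The centre \<open>x\<close> is itself a vertex, so the \<open>m + 1\<close>
    greedy points complete the \<open>m + 2\<close> vertices.\<close>
  define y where "y i = (case i of 0 \<Rightarrow> x | Suc j \<Rightarrow> v j)" for i
  have y: "y i \<in> ?S" if "i \<le> m + 1" for i
    using that v x r by (auto simp: y_def split: nat.split)
  define V where "V = unit_ball_vol (m + 1) / 4 ^ (m + 1) * (2 * c * h) ^ (m + 1)"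
  have V: "0 < V" using c h by (simp add: V_def)
  define \<kappa> where "\<kappa> = V / (4 * r) ^ (m + 2)"
  have curv: "\<kappa> \<le> menger_curvature m w"
    if w: "\<And>i. i \<le> m + 1 \<Longrightarrow> norm (w i - y i) \<le> \<rho>" for w
    unfolding \<kappa>_def
  proof (rule menger_curvature_ge[OF V])
    have "unit_ball_vol (real (m + 1)) / 4 ^ (m + 1)
        * (2 * (1 / (4 * 2 ^ (m + 1) * (real (m + 1) + 1))) * h) ^ (m + 1)
      \<le> measure (hausdorff_measure (m + 1)) (convex hull (w ` {..m + 1}))"
    proof (rule measure_perturbed_simplex_ge[where h = "\<lambda>i. (v i - x) \<bullet> e i" and v = y, OF orth h])
      show "norm (w i - y i) \<le> 1 / (4 * 2 ^ (m + 1) * (real (m + 1) + 1)) * h" if "i \<le> m + 1" for i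
        using w[OF that] by (simp add: \<rho>_def c_def)
    qed (use H v greedy_frame_coordinates(1,2)[OF fr] in \<open>auto simp: y_def\<close>)
    then show "V \<le> measure (hausdorff_measure (m + 1)) (convex hull (w ` {..m + 1}))"
      by (simp add: V_def c_def)
    have "norm (a - b) \<le> 4 * r" if ab: "a \<in> w ` {..m + 1}" "b \<in> w ` {..m + 1}" for a b
    proof -
      obtain i j where ij: "i \<le> m + 1" "a = w i" "j \<le> m + 1" "b = w j" using ab by auto
      have "dist a b \<le> dist (w i) (y i) + dist (y i) x + dist x (y j) + dist (y j) (w j)"
        unfolding ij by metric
      moreover have "dist (w i) (y i) \<le> \<rho>" "dist (y j) (w j) \<le> \<rho>"
        using w[OF ij(1)] w[OF ij(3)] by (simp_all add: dist_norm norm_minus_commute)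
      moreover have "dist (y i) x \<le> r" "dist x (y j) \<le> r"
        using y[OF ij(1)] y[OF ij(3)] by (auto simp: dist_commute)
      ultimately show ?thesis using \<rho> hr r by (simp add: dist_norm)
    qed
    then show "diameter (w ` {..m + 1}) \<le> 4 * r" using r by (intro diameter_le) auto
    \<comment> \<open>Two perturbations by at most \<open>h / 4\<close> cannot make vertices at
      distance at least \<open>h\<close> coincide.\<close>
    have "h \<le> dist (y 1) (y 0)" using norm_v[of 0] by (simp add: y_def dist_norm)
    also have "\<dots> \<le> dist (w 1) (y 1) + dist (w 0) (w 1) + dist (w 0) (y 0)" by metric
    also have "\<dots> \<le> 2 * \<rho> + dist (w 0) (w 1)" using w[of 0] w[of 1] by (simp add: dist_norm)
    finally show "w 0 \<noteq> w 1" using \<rho> h by auto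
  qed
  have \<kappa>: "0 < \<kappa>" using V r by (simp add: \<kappa>_def)
  define S where "S i = \<Sigma> \<inter> cball (y i) \<rho>" for i
  \<comment> \<open>Halving gives the strict inequality that the product inequality asks
    for.\<close>
  define M where "M = A * \<rho> ^ m / 2"
  have M: "0 < M" using A \<rho> by (simp add: M_def)
  have cS: "compact (S i)" for i unfolding S_def by (intro compact_Int_closed \<Sigma> closed_cball)
  have mS: "ennreal M < hausdorff_outer m (S i)" if "i < l" for i
  proof -
    have "ennreal M < ennreal (A * \<rho> ^ m)" using M by (intro ennreal_lessI) (auto simp: M_def)
    also have "\<dots> \<le> emeasure (hausdorff_measure m) (\<Sigma> \<inter> ball (y i) \<rho>)"
      using y[of i] that l \<rho> hr r by (intro ahl) auto
    also have "\<dots> = hausdorff_outer m (\<Sigma> \<inter> ball (y i) \<rho>)"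
      using borel_compact[OF \<Sigma>] by (intro emeasure_hausdorff_measure sets.Int) auto
    also have "\<dots> \<le> hausdorff_outer m (S i)" by (intro hausdorff_outer_mono) (auto simp: S_def)
    finally show ?thesis .
  qed
  let ?P = "product_tuples l S"
  have P: "?P \<in> sets borel" by (intro borel_compact compact_product_tuples cS)
  show "ennreal ((K * (h ^ (m + 1) / r ^ (m + 2))) powr p * (B * (A * h ^ m) ^ l)) \<le> menger_energy m l p \<Sigma>"
  proof -
    let ?F = "\<lambda>X. SUP z \<in> {l..m + 1} \<rightarrow> \<Sigma>.
      ennreal (menger_curvature m (\<lambda>i. if i < l then lookup X i else z i) powr p)"
    have "K * (h ^ (m + 1) / r ^ (m + 2)) = \<kappa>"
      by (simp add: K_def \<kappa>_def V_def power_mult_distrib mult_ac)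
    moreover have "B * (A * h ^ m) ^ l
        = unit_ball_vol (real (m * l)) / 4 ^ (m * l) * (M / (unit_ball_vol (real m) * (3 / 2) ^ m)) ^ l"
      by (simp add: B_def M_def \<rho>_def power_mult_distrib power_divide)
    ultimately have "ennreal ((K * (h ^ (m + 1) / r ^ (m + 2))) powr p * (B * (A * h ^ m) ^ l))
        = ennreal (\<kappa> powr p) * ennreal (unit_ball_vol (real (m * l)) / 4 ^ (m * l)
            * (M / (unit_ball_vol (real m) * (3 / 2) ^ m)) ^ l)"
      by (simp only: ennreal_mult' powr_ge_zero)
    also have "\<dots> \<le> ennreal (\<kappa> powr p) * hausdorff_outer (m * l) ?P"
      using hausdorff_outer_product[OF m l(1) M cS mS] by (intro mult_left_mono) auto
    also have "\<dots> = ennreal (\<kappa> powr p) * emeasure (hausdorff_measure (m * l)) ?P"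
      by (simp add: emeasure_hausdorff_measure[OF P])
    also have "\<dots> = (\<integral>\<^sup>+X. ennreal (\<kappa> powr p) * indicator ?P X \<partial>hausdorff_measure (m * l))"
      using P by (intro nn_integral_cmult_indicator[symmetric]) simp
    \<comment> \<open>Monotonicity of the nonnegative integral holds for arbitrary integrands, so a
      pointwise comparison is enough. In the supremum the vertices from \<open>l\<close> on are put
      at \<open>y i\<close>.\<close>
    also have "\<dots> \<le> (\<integral>\<^sup>+X \<in> tuples l \<Sigma>. ?F X \<partial>hausdorff_measure (m * l))"
    proof (rule nn_integral_mono)
      fix X
      show "ennreal (\<kappa> powr p) * indicator ?P X \<le> ?F X * indicator (tuples l \<Sigma>) X"
      proof (cases "X \<in> ?P")
        case True
        then have XS: "lookup X i \<in> S i" if "i < l" for i using that by (simp add: product_tuples_def)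
        have X\<Sigma>: "X \<in> tuples l \<Sigma>" using True by (auto simp: tuples_def product_tuples_def S_def)
        have "\<kappa> \<le> menger_curvature m (\<lambda>i. if i < l then lookup X i else y i)"
          using XS \<rho> by (intro curv) (auto simp: S_def dist_norm norm_minus_commute)
        then have "ennreal (\<kappa> powr p)
            \<le> ennreal (menger_curvature m (\<lambda>i. if i < l then lookup X i else y i) powr p)"
          using \<kappa> p by (intro ennreal_leI powr_mono2) auto
        also have "\<dots> \<le> ?F X" using y by (intro SUP_upper) auto
        finally show ?thesis using True X\<Sigma> by simp
      qed simp
    qed
    finally show ?thesis by (simp add: menger_energy_def)
  qed
qed

section \<open>From the energy bound to the beta number\<close>

text \<open>In terms of \<open>t = h / r\<close> the hypothesis bounds \<open>t\<close> to the power
  (m+1)p + ml by a multiple of E r^(p-ml) / A^l. Since \<open>t \<le> 1\<close>, the larger exponent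
  \<kappa> may replace this one before the root is taken.\<close>

lemma powr_bound_from_energy:
  fixes m l :: nat and p :: real
  assumes p: "real (m * l) < p" and m: "1 \<le> m" and Q: "0 < Q" and A: "0 < A" and E: "0 \<le> E"
    and h: "0 < h" "h \<le> r"
    and le: "Q * ((h ^ (m + 1) / r ^ (m + 2)) powr p * (A * h ^ m) ^ l) \<le> E"
  defines "\<kappa> \<equiv> (p + real (m * l)) * real (m + 1)"
  shows "h / r \<le> (1 / Q) powr (1 / \<kappa>) * (E / A ^ l) powr (1 / \<kappa>) * r powr ((p - real (m * l)) / \<kappa>)"
proof -
  define t where "t = h / r"
  have r: "0 < r" using h by linarith
  have t: "0 < t" "t \<le> 1" using h r by (auto simp: t_def)
  have ht: "h = t * r" using r by (simp add: t_def)
  have p0: "0 < p" using p of_nat_0_le_iff[of "m * l", where ?'a = real] by linarith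
  have \<kappa>: "0 < \<kappa>" using p0 by (simp add: \<kappa>_def add_pos_nonneg)
  have "h ^ (m + 1) / r ^ (m + 2) = t ^ (m + 1) / r"
    using r by (simp add: ht power_mult_distrib)
  also have "\<dots> = t powr real (m + 1) * r powr (- 1)"
    using t r by (simp only: powr_realpow) (simp add: powr_minus_divide)
  finally have 1: "(h ^ (m + 1) / r ^ (m + 2)) powr p = t powr (real (m + 1) * p) * r powr (- p)"
    using t r by (simp only: powr_mult powr_powr mult_minus1 powr_ge_zero)
  have "(A * h ^ m) ^ l = A ^ l * (t ^ (m * l) * r ^ (m * l))"
    by (simp add: ht power_mult_distrib power_mult)
  also have "\<dots> = A ^ l * (t powr real (m * l) * r powr real (m * l))"
    using t r by (simp only: powr_realpow)
  finally have 2: "(A * h ^ m) ^ l = A ^ l * (t powr real (m * l) * r powr real (m * l))" .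
  have "Q * A ^ l * t powr (real (m + 1) * p + real (m * l)) * r powr (real (m * l) - p) \<le> E"
    using le unfolding 1 2 by (simp add: powr_add powr_diff powr_minus field_simps)
  then have "t powr (real (m + 1) * p + real (m * l)) \<le> E / (Q * A ^ l * r powr (real (m * l) - p))"
    using Q A r by (simp add: field_simps)
  also have "\<dots> = 1 / Q * (E / A ^ l) * r powr (p - real (m * l))"
    by (simp add: powr_diff)
  finally have 3: "t powr (real (m + 1) * p + real (m * l)) \<le> 1 / Q * (E / A ^ l) * r powr (p - real (m * l))" .
  have "real (m + 1) * p + real (m * l) \<le> \<kappa>"
  proof -
    have "1 * real (m * l) \<le> real (m + 1) * real (m * l)" by (intro mult_right_mono) auto
    then show ?thesis by (simp only: \<kappa>_def) (simp add: algebra_simps)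
  qed
  then have "t powr \<kappa> \<le> t powr (real (m + 1) * p + real (m * l))"
    using t by (intro powr_mono') auto
  with 3 have "t powr \<kappa> \<le> 1 / Q * (E / A ^ l) * r powr (p - real (m * l))" by linarith
  then have "(t powr \<kappa>) powr (1 / \<kappa>) \<le> (1 / Q * (E / A ^ l) * r powr (p - real (m * l))) powr (1 / \<kappa>)"
    using \<kappa> by (intro powr_mono2) auto
  also have "\<dots> = (1 / Q) powr (1 / \<kappa>) * (E / A ^ l) powr (1 / \<kappa>) * r powr ((p - real (m * l)) / \<kappa>)"
    by (simp only: powr_mult powr_powr) simp
  also have "(t powr \<kappa>) powr (1 / \<kappa>) = h / r"
    unfolding powr_powr t_def[symmetric] using t \<kappa> by simp
  finally show ?thesis .
qed

theorem proposition1: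
  fixes m l :: nat and p :: real
  assumes "1 \<le> m" and "l \<in> {1..m + 2}" and "p > real (m * l)"
  shows "\<exists>C_A :: real. \<forall>(n :: nat) (\<Sigma> :: point set) (R_Ahl :: real) (A_Ahl :: real) (E :: real).
    m \<le> n \<longrightarrow> \<Sigma> \<subseteq> real_space n \<longrightarrow> compact \<Sigma> \<longrightarrow> R_Ahl > 0 \<longrightarrow> A_Ahl > 0 \<longrightarrow>
    (\<forall>x\<in>\<Sigma>. \<forall>r. 0 < r \<and> r \<le> R_Ahl \<longrightarrow>
       emeasure (hausdorff_measure m) (\<Sigma> \<inter> ball x r) \<ge> ennreal (A_Ahl * r ^ m)) \<longrightarrow>
    0 \<le> E \<longrightarrow> menger_energy m l p \<Sigma> \<le> ennreal E \<longrightarrow>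
    (\<forall>r x. 0 < r \<and> r \<le> R_Ahl \<and> x \<in> \<Sigma> \<longrightarrow>
       (let \<kappa> = (p + real (m * l)) * real (m + 1); \<mu> = p - real (m * l) in
        beta_number n m \<Sigma> x r \<le> C_A * (E / A_Ahl ^ l) powr (1 / \<kappa>) * r powr (\<mu> / \<kappa>)))"
proof -
  \<comment> \<open>All constants up to \<open>Q\<close> are fixed by \<open>m\<close>,
    \<open>l\<close> and \<open>p\<close>, ahead of \<open>n\<close> and \<Sigma>; the final
    constant is \<open>(1 / Q) powr (1 / \<kappa>)\<close>.\<close>
  define c where "c = 1 / (4 * 2 ^ (m + 1) * (real (m + 1) + 1))"
  define K where "K = unit_ball_vol (m + 1) / 4 ^ (m + 1) * (2 * c) ^ (m + 1) / 4 ^ (m + 2)"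
  define B where "B = unit_ball_vol (m * l) / 4 ^ (m * l) * (c ^ m / (2 * (unit_ball_vol m * (3 / 2) ^ m))) ^ l"
  define Q where "Q = K powr p * B"
  have c: "0 < c" by (simp add: c_def add_pos_nonneg)
  have K: "0 < K" using c by (simp add: K_def)
  have B: "0 < B" using c by (simp add: B_def)
  have Q: "0 < Q" using K B by (simp add: Q_def)
  have p: "0 \<le> p" using assms(3) of_nat_0_le_iff[of "m * l", where ?'a = real] by linarith
  define \<kappa> where "\<kappa> = (p + real (m * l)) * real (m + 1)"
  have main: "beta_number n m \<Sigma> x r
      \<le> (1 / Q) powr (1 / \<kappa>) * (E / A ^ l) powr (1 / \<kappa>) * r powr ((p - real (m * l)) / \<kappa>)"
    if n: "m \<le> n" and \<Sigma>: "\<Sigma> \<subseteq> real_space n" "compact \<Sigma>" and A: "0 < A"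
      and ahl: "\<forall>x\<in>\<Sigma>. \<forall>r. 0 < r \<and> r \<le> R \<longrightarrow> ennreal (A * r ^ m) \<le> emeasure (hausdorff_measure m) (\<Sigma> \<inter> ball x r)"
      and E: "0 \<le> E" "menger_energy m l p \<Sigma> \<le> ennreal E" and r: "0 < r" "r \<le> R" and x: "x \<in> \<Sigma>"
    for n \<Sigma> R A E r x
  proof -
    let ?S = "\<Sigma> \<inter> cball x r"
    have S: "compact ?S" "x \<in> ?S" "?S \<subseteq> real_space n"
      using \<Sigma> x r by (auto intro: compact_Int_closed)
    obtain e v where fr: "greedy_frame ?S x n m e v"
      using greedy_frame_exists[OF S n] by blast
    then have orth: "orthonormal_upto m e" and e: "\<And>i. i < m \<Longrightarrow> e i \<in> real_space n"
      by (auto simp: greedy_frame_def)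
    note beta = beta_number_le[OF orth e x r(1)]
    have rhs: "0 \<le> (1 / Q) powr (1 / \<kappa>) * (E / A ^ l) powr (1 / \<kappa>) * r powr ((p - real (m * l)) / \<kappa>)"
      by simp
    show ?thesis
    proof (cases "\<exists>z\<in>?S. residual e m (z - x) \<noteq> 0")
      case False
      then have "beta_number n m \<Sigma> x r \<le> 0 / r" by (intro beta) auto
      then have "beta_number n m \<Sigma> x r \<le> 0" by simp
      with rhs show ?thesis by linarith
    next
      case True
      \<comment> \<open>The extension keeps the first \<open>m\<close> directions, so the new height
        bounds the distances to the same plane that tests the beta number.\<close>
      with greedy_frame_Suc[OF fr S] obtain e' v' where fr': "greedy_frame ?S x n (Suc m) e' v'"
        and eq: "\<And>i. i < m \<Longrightarrow> e' i = e i"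
        by blast
      define h where "h = (v' m - x) \<bullet> e' m"
      have max: "norm (residual e m (z - x)) \<le> h" if "z \<in> ?S" for z
      proof -
        have "norm (residual e' m (z - x)) \<le> h"
          using fr' that unfolding greedy_frame_def h_def by blast
        then show ?thesis using residual_cong[of m e' e, OF eq] by simp
      qed
      from True obtain z where "z \<in> ?S" "residual e m (z - x) \<noteq> 0" by blast
      then have h: "0 < h" using max[of z] by (smt (verit) zero_less_norm_iff)
      have ahl': "ennreal (A * r ^ m) \<le> emeasure (hausdorff_measure m) (\<Sigma> \<inter> ball x r)"
        if "x \<in> \<Sigma>" "0 < r" "r \<le> R" for x r
        using ahl that by blast
      have l: "1 \<le> l" "l \<le> m + 2" using assms(2) by auto
      note energy = menger_energy_ge[OF assms(1) l p \<Sigma>(2) A ahl' x r fr' h[unfolded h_def], folded h_def c_def]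
      have "ennreal ((K * (h ^ (m + 1) / r ^ (m + 2))) powr p * (B * (A * h ^ m) ^ l)) \<le> ennreal E"
        using energy(2) E(2) unfolding K_def B_def by (rule order_trans)
      then have "(K * (h ^ (m + 1) / r ^ (m + 2))) powr p * (B * (A * h ^ m) ^ l) \<le> E"
        by (subst (asm) ennreal_le_iff) (rule E(1))
      then have "Q * ((h ^ (m + 1) / r ^ (m + 2)) powr p * (A * h ^ m) ^ l) \<le> E"
        unfolding Q_def powr_mult by (simp only: mult_ac)
      from powr_bound_from_energy[OF assms(3,1) Q A E(1) h energy(1) this]
      have "h / r \<le> (1 / Q) powr (1 / \<kappa>) * (E / A ^ l) powr (1 / \<kappa>) * r powr ((p - real (m * l)) / \<kappa>)"
        by (simp only: \<kappa>_def)
      moreover have "beta_number n m \<Sigma> x r \<le> h / r" by (intro beta max)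
      ultimately show ?thesis by linarith
    qed
  qed
  show ?thesis
    unfolding Let_def \<kappa>_def[symmetric]
    by (intro exI[of _ "(1 / Q) powr (1 / \<kappa>)"] allI impI) (use main in blast)
qed

end
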